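(* Suppose that: (A1) $\mathrm{D}G_0$ is $L_1$-Lipschitz on $\mathcal{X}$, and there is $m>0$ such that $\mathrm{Sym}(\mathrm{D}G_0(x)) \succeq \frac{m}{2} I$ for all $x\in\mathcal{X}$; (A2) $\Phi:\mathcal{X}\to\mathbb{R}$ is $\mu_\Phi$-strongly convex on $\mathcal{X}$ with $L_2$-Lipschitz gradient, and its unique minimizer $x^\dagger=\arg\min_{x\in\mathcal{X}}\Phi(x)$ lies in $\operatorname{int}\mathcal{X}$. Let $c^*=\min_{x\in\partial\mathcal{X}}\Phi(x)-\Phi(x^\dagger)>0$, let $p^\dagger=-G_0(x^\dagger)$, fix $0<c<c^*$, and let $\mathcal{P}_c=\{p\in\mathcal{P}:\Phi(x^*(p))-\Phi(x^\dagger)\le c\}$. Suppose further that: (A3) $f:\mathcal{X}\times\mathcal{P}_c\to\mathcal{X}$ is jointly $L_f$-Lipschitz, and there exists a class-$\mathcal{KL}$ function $\phi$ such that every solution $x(t)$ of $\dot x=f(x,p)-x$ satisfies $\|x(t)-x^*(p)\|_2\le\phi(\|x(0)-x^*(p)\|_2,t)$ for all $t\ge0$, $x(0)\in\mathcal{X}$ and $p\in\mathcal{P}_c$; (A4) the sequences $a_k\in(0,1]$ and $\beta_k>0$ satisfy $\sum_{k=0}^\infty a_k=\sum_{k=0}^\infty\beta_k=\infty$, $\sum_{k=0}^\infty(a_k^2+\beta_k^2)<\infty$, and $\beta_k=o(a_k)$. Then, for any initial condition $(x_0,p_0)\in\mathcal{X}\times\mathcal{P}_c$, the sequence $(x_k,p_k)_{k\ge0}$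 generated by $$x_{k+1}=x_k+a_k\big(f(x_k,p_k)-x_k\big),$$ $$p_{k+1}=p_k+\beta_k\nabla\Phi(x_k)\,\mathbf{1}\{p_k+\beta_k\nabla\Phi(x_k)\in\mathcal{P}_c\}$$ satisfies $$\lim_{k\to\infty}\|x_k-x^*(p_k)\|_2=0\quad\text{and}\quad\lim_{k\to\infty}p_k=p^\dagger.$$ Consequently, $(x_k,p_k)\to(x^\dagger,p^\dagger)$ as $k\to\infty$.
   Context: Setting. There are $n$ agents $\mathcal N=\{1,\dots,n\}$. Agent $i$ has a compact convex strategy set $\mathcal{X}_i\subset\mathbb{R}$, and $\mathcal{X}=\prod_{i}\mathcal{X}_i\subset\mathbb{R}^n$. Each agent has a nominal cost $\ell_i:\mathcal{X}\to\mathbb{R}$ of class $C^2$. Given an incentive $p=(p_i)_i\in\mathbb{R}^n$, agent $i$'s total cost is $c_i^\gamma(x)=\ell_i(x)+p_ix_i$. The nominal pseudo-gradient is $G_0(x)=\big(\tfrac{\partial \ell_1}{\partial x_1}(x),\dots,\tfrac{\partial \ell_n}{\partial x_n}(x)\big)^\top$ and the incentivized pseudo-gradient is $G_\gamma(x)=G_0(x)+p$. $\mathrm{D}F$ denotes the Jacobian of $F$, $\mathrm{Sym}(A)=\frac12(A+A^\top)$, and $I$ is the identity matrix. For $p\in\mathbb{R}^n$, an incentivized Nash equilibrium is a point $x^*(p)\in\mathcal{X}$ with $G_\gamma(x^*(p))^\top(x-x^*(p))\ge 0$ for all $x\in\mathcal{X}$; under (A1) it exists and is unique for every $p$. The map $p\mapsto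 x^*(p)$ is called the response map. The set $\mathcal{P}$ is $\mathcal{P}=-G_0(\operatorname{int}\mathcal{X})\subset\mathbb{R}^n$. A function $f$ is $\mu$-strongly convex on $\mathcal{X}$ if $f(y)\ge f(x)+\langle\nabla f(x),y-x\rangle+\frac{\mu}{2}\|y-x\|^2$ for all $x,y\in\mathcal{X}$. $\partial\mathcal{X}$ denotes the topological boundary of $\mathcal{X}$. $\mathbf{1}\{\cdot\}$ is the indicator, equal to $1$ if the condition holds and $0$ otherwise. $\beta_k=o(a_k)$ means $\beta_k/a_k\to0$ as $k\to\infty$. A class-$\mathcal{KL}$ function is a continuous $\phi:[0,\infty)\times[0,\infty)\to[0,\infty)$ such that $\phi(\cdot,t)$ is strictly increasing with $\phi(0,t)=0$ for each $t$, and $\phi(r,\cdot)$ is decreasing with $\phi(r,t)\to0$ as $t\to\infty$ for each $r$. *)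

theory Defs
  imports "HOL-Analysis.Analysis"
begin

text \<open>Calculus relative to a set \<open>X\<close>. All derivatives are taken within \<open>X\<close>, since the functions of
  interest are only defined there; on a convex set with nonempty interior they are unique, also at
  boundary points.\<close>

definition gradient_within :: "(real^'n \<Rightarrow> real) \<Rightarrow> (real^'n) set \<Rightarrow> real^'n \<Rightarrow> real^'n" where
  "gradient_within f X x = (\<chi> i. frechet_derivative f (at x within X) (axis i 1))"

lemma has_derivative_gradient_within:
  assumes "f differentiable (at x within X)"
  shows "(f has_derivative (\<lambda>h. gradient_within f X x \<bullet> h)) (at x within X)"
proof -
  let ?D = "frechet_derivative f (at x within X)"
  have D: "(f has_derivative ?D) (at x within X)"
    using assms frechet_derivative_works by blast
  then interpret linear ?D by (rule has_derivative_linear)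
  have "?D h = gradient_within f X x \<bullet> h" for h
  proof -
    have "?D h = ?D (\<Sum>i\<in>UNIV. (h $ i) *\<^sub>R axis i 1)"
      using basis_expansion[of h] by (simp add: scalar_mult_eq_scaleR)
    also have "\<dots> = (\<Sum>i\<in>UNIV. h $ i * ?D (axis i 1))"
      by (simp add: sum scale)
    finally show ?thesis
      by (simp add: gradient_within_def inner_vec_def mult.commute)
  qed
  then have "?D = (\<lambda>h. gradient_within f X x \<bullet> h)" by blast
  with D show ?thesis by simp
qed

definition C2_on :: "(real^'n \<Rightarrow> real) \<Rightarrow> (real^'n) set \<Rightarrow> bool" where
  "C2_on f X \<longleftrightarrow>
    (\<exists>(g :: real^'n \<Rightarrow> real^'n) (H :: real^'n \<Rightarrow> real^'n^'n).
      (\<forall>x\<in>X. (f has_derivative (\<lambda>h. g x \<bullet> h)) (at x within X)) \<and>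
      (\<forall>x\<in>X. (g has_derivative (\<lambda>h. H x *v h)) (at x within X)) \<and>
      continuous_on X H)"

definition strongly_convex_on :: "real \<Rightarrow> (real^'n) set \<Rightarrow> (real^'n \<Rightarrow> real) \<Rightarrow> bool" where
  "strongly_convex_on \<mu> X f \<longleftrightarrow>
    \<mu> > 0 \<and> f differentiable_on X \<and>
    (\<forall>x\<in>X. \<forall>y\<in>X. f y \<ge> f x + gradient_within f X x \<bullet> (y - x) + \<mu> / 2 * (norm (y - x))\<^sup>2)"

definition Sym :: "real^'n^'n \<Rightarrow> real^'n^'n" where
  "Sym A = (1/2) *\<^sub>R (A + transpose A)"

definition psd :: "real^'n^'n \<Rightarrow> bool" where
  "psd A \<longleftrightarrow> transpose A = A \<and> (\<forall>v. 0 \<le> v \<bullet> (A *v v))"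

definition loewner_ge :: "real^'n^'n \<Rightarrow> real^'n^'n \<Rightarrow> bool"  (infix "\<succeq>" 50) where
  "A \<succeq> B \<longleftrightarrow> psd (A - B)"

text \<open>For class \<open>KL\<close>, decreasing in the second argument means nonincreasing: strict decrease is
  impossible at \<open>r = 0\<close>.\<close>

definition class_KL :: "(real \<Rightarrow> real \<Rightarrow> real) \<Rightarrow> bool" where
  "class_KL \<phi> \<longleftrightarrow>
    continuous_on ({0..} \<times> {0..}) (\<lambda>(r, t). \<phi> r t) \<and>
    (\<forall>r\<ge>0. \<forall>t\<ge>0. \<phi> r t \<ge> 0) \<and>
    (\<forall>t\<ge>0. strict_mono_on {0..} (\<lambda>r. \<phi> r t) \<and> \<phi> 0 t = 0) \<and>
    (\<forall>r\<ge>0. antimono_on {0..} (\<phi> r) \<and> (\<phi> r \<longlongrightarrow> 0) at_top)"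

text \<open>The game. Agent \<open>i\<close> has the strategy set \<open>S i\<close> and the nominal cost \<open>l i\<close>.\<close>

definition strategy_space :: "('n \<Rightarrow> real set) \<Rightarrow> (real^'n) set" where
  "strategy_space S = {x. \<forall>i. x $ i \<in> S i}"

definition pseudo_gradient ::
    "('n \<Rightarrow> real set) \<Rightarrow> ('n \<Rightarrow> real^'n \<Rightarrow> real) \<Rightarrow> real^'n \<Rightarrow> real^'n" where
  "pseudo_gradient S l x =
    (\<chi> i. vector_derivative (\<lambda>t. l i (\<chi> j. if j = i then t else x $ j)) (at (x $ i) within S i))"

definition incentivized_pseudo_gradient ::
    "('n \<Rightarrow> real set) \<Rightarrow> ('n \<Rightarrow> real^'n \<Rightarrow> real) \<Rightarrow> real^'n \<Rightarrow> real^'n \<Rightarrow> real^'n" where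
  "incentivized_pseudo_gradient S l p x = pseudo_gradient S l x + p"

definition incentivized_nash ::
    "('n \<Rightarrow> real set) \<Rightarrow> ('n \<Rightarrow> real^'n \<Rightarrow> real) \<Rightarrow> real^'n \<Rightarrow> real^'n \<Rightarrow> bool" where
  "incentivized_nash S l p y \<longleftrightarrow>
    y \<in> strategy_space S \<and>
    (\<forall>x\<in>strategy_space S. incentivized_pseudo_gradient S l p y \<bullet> (x - y) \<ge> 0)"

definition response ::
    "('n \<Rightarrow> real set) \<Rightarrow> ('n \<Rightarrow> real^'n \<Rightarrow> real) \<Rightarrow> real^'n \<Rightarrow> real^'n" where
  \<comment> \<open>well defined for every \<open>p\<close> when the pseudo-gradient is continuous and strongly monotone\<close>
  "response S l p = (THE y. incentivized_nash S l p y)"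

definition interior_incentives ::
    "('n \<Rightarrow> real set) \<Rightarrow> ('n \<Rightarrow> real^'n \<Rightarrow> real) \<Rightarrow> (real^'n) set" where
  "interior_incentives S l = (\<lambda>x. - pseudo_gradient S l x) ` interior (strategy_space S)"

end

theory Submission
  imports Defs
begin

text \<open>
  The recursion has two time scales. Since \<open>\<beta> k / a k \<rightarrow> 0\<close>, the incentive looks constant to the agents
  while they settle, and the agents look settled to the incentive.

  Fast scale. With the incentive frozen at \<open>q\<close>, the agents' update is the Euler scheme of
  \<open>\<xi>' = f (\<xi>, q) - \<xi>\<close>. This flow exists for all time and stays in the convex set \<open>X\<close>
  (\<open>relaxation_flow_exists\<close>), so that the stability assumption applies to it: some time \<open>T\<close>, uniform in
  \<open>q\<close> and in the starting point, brings every trajectory close to the response. Given a late index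
  \<open>n\<close>, one looks back to the index \<open>k\<close> for which the steps between \<open>k\<close> and \<open>n\<close> sum to about \<open>T\<close> and
  restarts the flow from \<open>x k\<close> with incentive \<open>p k\<close>. Over this window of bounded length, the Euler
  error and the drift of the incentive are both small by a discrete Gronwall estimate
  (\<open>euler_shadows_frozen_flow\<close>), hence \<open>x n\<close> is close to the response to \<open>p n\<close>
  (\<open>fast_iterate_tracks_response\<close>).

  Slow scale. Let \<open>y k\<close> be the response to \<open>p k\<close>, that is, \<open>p k = - G\<^sub>0 (y k)\<close>. The update adds
  \<open>\<beta>\<nabla>\<Phi>\<close> to \<open>p\<close>, so it moves \<open>y\<close> to a point \<open>z\<close> with \<open>G\<^sub>0 z = G\<^sub>0 y - \<beta>\<nabla>\<Phi>\<close>. Testing strong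
  monotonicity of \<open>G\<^sub>0\<close> with \<open>z - y\<close> shows that \<open>z - y\<close> is a descent direction of \<open>\<Phi>\<close>, and together
  with the Polyak-Lojasiewicz inequality this contracts the gap \<open>\<Phi> - \<Phi> x\<^sub>d\<close> by the factor
  \<open>1 - \<kappa> \<beta>\<close>, up to \<open>\<beta>\<close> times a vanishing error (\<open>inexact_dual_step_decrease\<close>). The same inequality shows that from some index on no update is
  rejected: the admissible incentives are compact inside the open set \<open>- G\<^sub>0 (interior X)\<close> (open by
  invariance of domain), so a small step stays in the latter, and the contraction keeps the gap
  below \<open>c\<close>. As \<open>\<Sum>\<beta> = \<infinity>\<close>, the gap tends to zero (\<open>guarded_incentive_response_converges\<close>).
\<close>

section \<open>Existence and invariance of relaxation flows\<close>


lemma norm_integral_exp_bound: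
  fixes h :: "real \<Rightarrow> 'a::euclidean_space"
  assumes "continuous_on {0..t} h" "0 < \<kappa>" "0 \<le> t" "0 \<le> K"
    and bound: "\<And>s. s \<in> {0..t} \<Longrightarrow> norm (h s) \<le> K * exp (\<kappa> * s)"
  shows "norm (integral {0..t} h) \<le> K * exp (\<kappa> * t) / \<kappa>"
proof -
  have hi: "((\<lambda>s. K * exp (\<kappa> * s)) has_integral (K * exp (\<kappa> * t) / \<kappa> - K * exp (\<kappa> * 0) / \<kappa>)) {0..t}"
    using assms by (intro fundamental_theorem_of_calculus)
      (auto intro!: derivative_eq_intros simp: has_real_derivative_iff_has_vector_derivative[symmetric])
  have "norm (integral {0..t} h) \<le> integral {0..t} (\<lambda>s. K * exp (\<kappa> * s))"
    using assms by (intro integral_norm_bound_integral integrable_continuous_real continuous_intros) auto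
  also have "\<dots> = K * exp (\<kappa> * t) / \<kappa> - K / \<kappa>"
    using hi by (auto dest: integral_unique)
  also have "\<dots> \<le> K * exp (\<kappa> * t) / \<kappa>"
    using assms by simp
  finally show ?thesis .
qed

text \<open>A solution \<open>\<xi>\<close> grows at most exponentially, and \<open>\<eta> t = exp (- \<kappa> * t) *\<^sub>R \<xi> t\<close> is bounded when \<open>\<kappa>\<close>
  exceeds the Lipschitz constant \<open>L\<close>. In terms of \<open>\<eta>\<close> the Picard operator is a contraction with factor
  \<open>L / \<kappa>\<close> for the sup norm, whence Banach's theorem gives a solution on the whole half-line at once.\<close>

lemma global_ODE_solution:
  fixes G :: "'a::euclidean_space \<Rightarrow> 'a"
  assumes lip: "L-lipschitz_on UNIV G"
  obtains \<xi> where "\<xi> 0 = y\<^sub>0" "\<And>t. 0 \<le> t \<Longrightarrow> (\<xi> has_vector_derivative G (\<xi> t)) (at t within {0..})"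
proof -
  define \<kappa> where "\<kappa> = L + 1"
  have L: "0 \<le> L" "0 < \<kappa>" using lipschitz_on_nonneg[OF lip] by (auto simp: \<kappa>_def)
  have contG: "continuous_on UNIV G" using lip by (rule lipschitz_on_continuous_on)
  define rhs where "rhs \<eta> s = G (exp (\<kappa> * s) *\<^sub>R apply_bcontfun \<eta> s)" for \<eta> :: "real \<Rightarrow>\<^sub>C 'a" and s
  have cont_rhs: "continuous_on T (rhs \<eta>)" for \<eta> T
    unfolding rhs_def
    by (intro continuous_on_compose2[OF contG] continuous_intros) auto
  define J where "J \<eta> t = integral {0..t} (rhs \<eta>)" for \<eta> t
  \<comment> \<open>freezing time at \<open>0\<close> for negative arguments extends the operator to functions on the whole line\<close>
  define W where "W \<eta> r = (let t = max 0 r in exp (- \<kappa> * t) *\<^sub>R (y\<^sub>0 + J \<eta> t))" for \<eta> and r :: real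
  have deriv_J: "(J \<eta> has_vector_derivative rhs \<eta> t) (at t within {0..})" if "0 \<le> t" for \<eta> t
  proof -
    have "(J \<eta> has_vector_derivative rhs \<eta> t) (at t within {0..t+1})"
      unfolding J_def using that by (intro integral_has_vector_derivative cont_rhs) auto
    moreover have "at t within {0..t+1} = at t within {0..}"
      by (rule at_within_nhd[of _ "{..<t+1}"]) auto
    ultimately show ?thesis by simp
  qed
  then have cont_J: "continuous_on {0..} (J \<eta>)" for \<eta>
    by (auto simp: continuous_on_eq_continuous_within intro: has_vector_derivative_continuous)
  have W_bcontfun: "W \<eta> \<in> bcontfun" for \<eta>
  proof -
    have "continuous_on UNIV (W \<eta>)"
      unfolding W_def Let_def
      by (intro continuous_intros continuous_on_compose2[OF cont_J]) auto
    moreover have "bounded (range (W \<eta>))"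
    proof -
      obtain C where C: "\<And>s. norm (apply_bcontfun \<eta> s) \<le> C" "0 \<le> C"
        by (metis bounded_apply_bcontfun bounded_pos less_imp_le rangeI)
      define K where "K = norm (G 0) + L * C"
      have "0 \<le> K" using L C by (simp add: K_def)
      have "norm (W \<eta> r) \<le> norm y\<^sub>0 + K / \<kappa>" for r
      proof -
        define t where "t = max 0 r"
        have t: "0 \<le> t" by (simp add: t_def)
        have "norm (rhs \<eta> s) \<le> K * exp (\<kappa> * s)" if "s \<in> {0..t}" for s
        proof -
          let ?y = "exp (\<kappa> * s) *\<^sub>R apply_bcontfun \<eta> s"
          have e: "1 \<le> exp (\<kappa> * s)" using that L by simp
          have "norm (rhs \<eta> s) \<le> norm (G 0) + norm (G ?y - G 0)"
            unfolding rhs_def by (metis norm_triangle_sub)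
          also have "norm (G ?y - G 0) \<le> L * norm (?y - 0)"
            using lipschitz_onD[OF lip, of ?y 0] by (simp add: dist_norm)
          also have "norm (?y - 0) \<le> C * exp (\<kappa> * s)"
            using C by (simp add: mult.commute)
          finally have "norm (rhs \<eta> s) \<le> norm (G 0) + L * (C * exp (\<kappa> * s))"
            using L by (simp add: mult_left_mono)
          also have "norm (G 0) \<le> norm (G 0) * exp (\<kappa> * s)"
            using e by (simp add: mult_le_cancel_left1)
          finally show ?thesis by (simp add: K_def algebra_simps)
        qed
        then have "norm (J \<eta> t) \<le> K * exp (\<kappa> * t) / \<kappa>"
          unfolding J_def using t L \<open>0 \<le> K\<close> by (intro norm_integral_exp_bound cont_rhs) auto
        then have "norm (y\<^sub>0 + J \<eta> t) \<le> norm y\<^sub>0 + K * exp (\<kappa> * t) / \<kappa>"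
          by (intro norm_triangle_le) simp
        then have "exp (- \<kappa> * t) * norm (y\<^sub>0 + J \<eta> t) \<le> exp (- \<kappa> * t) * (norm y\<^sub>0 + K * exp (\<kappa> * t) / \<kappa>)"
          by (intro mult_left_mono) auto
        also have "\<dots> = exp (- \<kappa> * t) * norm y\<^sub>0 + K / \<kappa>"
          by (simp add: algebra_simps exp_minus)
        also have "exp (- \<kappa> * t) * norm y\<^sub>0 \<le> norm y\<^sub>0"
          using t L by (intro mult_left_le_one_le) auto
        finally show ?thesis by (simp add: W_def Let_def t_def)
      qed
      then show ?thesis by (auto simp: bounded_iff)
    qed
    ultimately show ?thesis by (simp add: bcontfun_def)
  qed
  define Wc where "Wc \<eta> = Bcontfun (W \<eta>)" for \<eta>
  have Wc: "apply_bcontfun (Wc \<eta>) = W \<eta>" for \<eta>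
    unfolding Wc_def using W_bcontfun by (simp add: Bcontfun_inverse)
  have "dist (Wc \<eta>) (Wc \<zeta>) \<le> L / \<kappa> * dist \<eta> \<zeta>" for \<eta> \<zeta>
  proof (rule dist_bound)
    fix r :: real
    define t where "t = max 0 r"
    have t: "0 \<le> t" by (simp add: t_def)
    have "J \<eta> t - J \<zeta> t = integral {0..t} (\<lambda>s. rhs \<eta> s - rhs \<zeta> s)"
      unfolding J_def by (intro integral_diff[symmetric] integrable_continuous_real cont_rhs)
    also have "norm \<dots> \<le> L * dist \<eta> \<zeta> * exp (\<kappa> * t) / \<kappa>"
    proof (intro norm_integral_exp_bound)
      fix s assume "s \<in> {0..t}"
      have "norm (rhs \<eta> s - rhs \<zeta> s) \<le> L * norm (exp (\<kappa> * s) *\<^sub>R apply_bcontfun \<eta> s - exp (\<kappa> * s) *\<^sub>R apply_bcontfun \<zeta> s)"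
        unfolding rhs_def using lipschitz_on_normD[OF lip] by blast
      also have "\<dots> = L * (exp (\<kappa> * s) * dist (apply_bcontfun \<eta> s) (apply_bcontfun \<zeta> s))"
        by (simp add: dist_norm flip: scaleR_diff_right)
      also have "\<dots> \<le> L * (exp (\<kappa> * s) * dist \<eta> \<zeta>)"
        using L by (intro mult_left_mono dist_bounded) auto
      finally show "norm (rhs \<eta> s - rhs \<zeta> s) \<le> L * dist \<eta> \<zeta> * exp (\<kappa> * s)" by (simp add: mult_ac)
    qed (use L t in \<open>auto intro!: continuous_intros cont_rhs\<close>)
    finally have "exp (- \<kappa> * t) * norm (J \<eta> t - J \<zeta> t) \<le> exp (- \<kappa> * t) * (L * dist \<eta> \<zeta> * exp (\<kappa> * t) / \<kappa>)"
      by (intro mult_left_mono) auto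
    also have "\<dots> = L / \<kappa> * dist \<eta> \<zeta>"
      by (simp add: exp_minus)
    finally show "dist (apply_bcontfun (Wc \<eta>) r) (apply_bcontfun (Wc \<zeta>) r) \<le> L / \<kappa> * dist \<eta> \<zeta>"
      by (simp add: Wc W_def Let_def t_def dist_norm flip: scaleR_diff_right)
  qed
  moreover have "0 \<le> L / \<kappa>" "L / \<kappa> < 1" using L by (auto simp: \<kappa>_def)
  ultimately obtain \<eta> where \<eta>: "Wc \<eta> = \<eta>"
    using banach_fix_type[of "L / \<kappa>" Wc] by auto
  define \<xi> where "\<xi> t = y\<^sub>0 + J \<eta> t" for t
  have \<xi>: "exp (\<kappa> * t) *\<^sub>R apply_bcontfun \<eta> t = \<xi> t" if "0 \<le> t" for t
  proof -
    have "apply_bcontfun \<eta> t = exp (- \<kappa> * t) *\<^sub>R \<xi> t"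
      using that Wc[of \<eta>] unfolding \<eta> by (simp add: W_def \<xi>_def)
    then show ?thesis by (simp flip: exp_add)
  qed
  show thesis
  proof
    show "\<xi> 0 = y\<^sub>0" by (simp add: \<xi>_def J_def)
    show "(\<xi> has_vector_derivative G (\<xi> t)) (at t within {0..})" if "0 \<le> t" for t
      using deriv_J[OF that, of \<eta>] \<xi>[OF that] unfolding \<xi>_def rhs_def
      by (auto intro!: derivative_eq_intros)
  qed
qed

text \<open>If \<open>v \<bullet> y > b\<close> holds on \<open>X\<close>, then \<open>exp s * (v \<bullet> \<xi> s - b)\<close> has derivative
  \<open>exp s * (v \<bullet> F s - b) > 0\<close>, so \<open>\<xi>\<close> never crosses a hyperplane that bounds \<open>X\<close>.\<close>

lemma relaxation_flow_stays_in_convex: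
  fixes F :: "real \<Rightarrow> 'a::euclidean_space"
  assumes X: "convex X" "closed X"
    and init: "\<xi> 0 \<in> X" and F: "\<And>t. 0 \<le> t \<Longrightarrow> F t \<in> X"
    and deriv: "\<And>t. 0 \<le> t \<Longrightarrow> (\<xi> has_vector_derivative F t - \<xi> t) (at t within {0..})"
    and t: "0 \<le> t"
  shows "\<xi> t \<in> X"
proof (rule ccontr)
  assume "\<xi> t \<notin> X"
  then obtain v b where v: "v \<bullet> \<xi> t < b" and b: "\<And>y. y \<in> X \<Longrightarrow> b < v \<bullet> y"
    using separating_hyperplane_closed_point[OF X] by blast
  define u where "u s = exp s * (v \<bullet> \<xi> s - b)" for s
  have "(u has_derivative (\<lambda>h. h * (exp s * (v \<bullet> F s - b)))) (at s within {0..t})" if "0 \<le> s" for s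
  proof -
    have "(\<xi> has_derivative (\<lambda>h. h *\<^sub>R (F s - \<xi> s))) (at s within {0..t})"
      using has_vector_derivative_within_subset[OF deriv[OF that], of "{0..t}"]
      by (simp add: has_vector_derivative_def)
    then show ?thesis
      unfolding u_def
      by (auto intro!: derivative_eq_intros simp: algebra_simps inner_diff_right)
  qed
  then obtain s where s: "s \<in> {0..t}" "u t - u 0 = (t - 0) * (exp s * (v \<bullet> F s - b))"
    using mvt_very_simple[OF t, of u "\<lambda>s h. h * (exp s * (v \<bullet> F s - b))"] by auto
  have "0 \<le> exp s * (v \<bullet> F s - b)" using b[OF F[of s]] s by simp
  then have "u 0 \<le> u t" using s t by (metis diff_ge_0_iff_ge diff_zero mult_nonneg_nonneg)
  moreover have "0 < u 0" using b[OF init] by (simp add: u_def)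
  moreover have "u t < 0" using v by (simp add: u_def mult_pos_neg)
  ultimately show False by simp
qed

text \<open>Composing \<open>F\<close> with the nearest-point projection makes it globally Lipschitz; the resulting solution
  never leaves \<open>X\<close>, where the projection does nothing.\<close>

lemma relaxation_flow_exists:
  fixes F :: "'a::euclidean_space \<Rightarrow> 'a"
  assumes X: "convex X" "closed X" "y\<^sub>0 \<in> X"
    and F: "F \<in> X \<rightarrow> X" "L-lipschitz_on X F"
  obtains \<xi> where "\<xi> 0 = y\<^sub>0" "\<And>t. 0 \<le> t \<Longrightarrow> \<xi> t \<in> X"
    "\<And>t. 0 \<le> t \<Longrightarrow> (\<xi> has_vector_derivative F (\<xi> t) - \<xi> t) (at t within {0..})"
proof -
  define \<pi> where "\<pi> = closest_point X"
  have \<pi>: "\<pi> y \<in> X" for y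
    unfolding \<pi>_def using X by (intro closest_point_in_set) auto
  have "1-lipschitz_on UNIV \<pi>"
    unfolding \<pi>_def using X closest_point_lipschitz[of X] by (intro lipschitz_onI) auto
  moreover have "L-lipschitz_on (\<pi> ` UNIV) F"
    using \<pi> by (intro lipschitz_on_subset[OF F(2)]) auto
  ultimately have "(L * 1)-lipschitz_on UNIV (\<lambda>y. F (\<pi> y))"
    using lipschitz_on_compose2 by blast
  then have "(L + 1)-lipschitz_on UNIV (\<lambda>y. F (\<pi> y) - y)"
    by (intro lipschitz_on_diff) (auto intro: lipschitz_intros)
  then obtain \<xi> where \<xi>: "\<xi> 0 = y\<^sub>0"
      "\<And>t. 0 \<le> t \<Longrightarrow> (\<xi> has_vector_derivative F (\<pi> (\<xi> t)) - \<xi> t) (at t within {0..})"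
    by (rule global_ODE_solution[where y\<^sub>0 = y\<^sub>0]) blast
  have in_X: "\<xi> t \<in> X" if "0 \<le> t" for t
    using relaxation_flow_stays_in_convex[of X \<xi> "\<lambda>t. F (\<pi> (\<xi> t))" t] X \<xi> F(1) \<pi> that by auto
  then have "\<pi> (\<xi> t) = \<xi> t" if "0 \<le> t" for t
    using that by (simp add: \<pi>_def closest_point_self)
  then have "(\<xi> has_vector_derivative F (\<xi> t) - \<xi> t) (at t within {0..})" if "0 \<le> t" for t
    using \<xi>(2)[OF that] that by simp
  with \<xi>(1) in_X show thesis by (rule that)
qed

section \<open>Euler iterates shadow the flow with frozen parameter\<close>

lemma norm_diff_le_of_derivative_bound:
  fixes f :: "real \<Rightarrow> 'a::real_normed_vector"
  assumes "s \<le> t" "\<And>r. s \<le> r \<Longrightarrow> r \<le> t \<Longrightarrow> (f has_vector_derivative f' r) (at r within {s..t})"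
    and "\<And>r. s \<le> r \<Longrightarrow> r \<le> t \<Longrightarrow> norm (f' r) \<le> B"
  shows "norm (f t - f s) \<le> B * (t - s)"
proof -
  have "norm (f t - f s) \<le> B * norm (t - s)"
  proof (rule differentiable_bound[of "{s..t}" f "\<lambda>r h. h *\<^sub>R f' r"])
    fix r assume r: "r \<in> {s..t}"
    show "(f has_derivative (\<lambda>h. h *\<^sub>R f' r)) (at r within {s..t})"
      using assms(2) r by (simp add: has_vector_derivative_def)
    show "onorm (\<lambda>h. h *\<^sub>R f' r) \<le> B"
      using assms(3) r by (simp add: onorm_scaleR_left[OF bounded_linear_ident] onorm_id)
  qed (use assms in auto)
  then show ?thesis using assms(1) by simp
qed

text \<open>The velocity is bounded by the diameter \<open>D\<close> and is \<open>L + 1\<close>-Lipschitz in the position, so over a time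
  \<open>h\<close> it changes by at most \<open>(L + 1) * D * h\<close>.\<close>

lemma euler_step_error:
  fixes F :: "'a::euclidean_space \<Rightarrow> 'a"
  assumes F: "F \<in> X \<rightarrow> X" "L-lipschitz_on X F"
    and diam: "\<And>y z. y \<in> X \<Longrightarrow> z \<in> X \<Longrightarrow> norm (y - z) \<le> D"
    and \<xi>: "\<And>t. 0 \<le> t \<Longrightarrow> \<xi> t \<in> X"
      "\<And>t. 0 \<le> t \<Longrightarrow> (\<xi> has_vector_derivative F (\<xi> t) - \<xi> t) (at t within {0..})"
    and t: "0 \<le> t" "0 \<le> h"
  shows "norm (\<xi> (t + h) - (\<xi> t + h *\<^sub>R (F (\<xi> t) - \<xi> t))) \<le> (L + 1) * D * h\<^sup>2"
proof -
  have L: "0 \<le> L" using lipschitz_on_nonneg[OF F(2)] .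
  have deriv: "(\<xi> has_vector_derivative F (\<xi> r) - \<xi> r) (at r within {t..s})" if "t \<le> r" for r s
    using has_vector_derivative_within_subset[OF \<xi>(2), of r "{t..s}"] that t by auto
  have moves: "norm (\<xi> s - \<xi> t) \<le> D * (s - t)" if "t \<le> s" for s
    using \<xi>(1) F(1) t that
    by (intro norm_diff_le_of_derivative_bound[OF _ deriv] diam) auto
  define \<zeta> where "\<zeta> s = \<xi> s - s *\<^sub>R (F (\<xi> t) - \<xi> t)" for s
  have "norm (\<zeta> (t + h) - \<zeta> t) \<le> ((L + 1) * D * h) * (t + h - t)"
  proof (rule norm_diff_le_of_derivative_bound)
    fix s assume s: "t \<le> s" "s \<le> t + h"
    show "(\<zeta> has_vector_derivative (F (\<xi> s) - \<xi> s) - (F (\<xi> t) - \<xi> t)) (at s within {t..t + h})"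
      unfolding \<zeta>_def by (auto intro!: derivative_eq_intros deriv s)
    have "norm ((F (\<xi> s) - \<xi> s) - (F (\<xi> t) - \<xi> t)) \<le> norm (F (\<xi> s) - F (\<xi> t)) + norm (\<xi> s - \<xi> t)"
      by norm
    also have "\<dots> \<le> L * norm (\<xi> s - \<xi> t) + norm (\<xi> s - \<xi> t)"
      using lipschitz_on_normD[OF F(2)] \<xi>(1) s t by (intro add_right_mono) auto
    also have "\<dots> = (L + 1) * norm (\<xi> s - \<xi> t)" by (simp add: algebra_simps)
    also have "\<dots> \<le> (L + 1) * (D * h)"
    proof -
      have "0 \<le> D" using diam[OF \<xi>(1) \<xi>(1), of 0 0] by simp
      then have "D * (s - t) \<le> D * h" using s by (intro mult_left_mono) auto
      then show ?thesis using moves[OF s(1)] L by (intro mult_left_mono) auto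
    qed
    finally show "norm ((F (\<xi> s) - \<xi> s) - (F (\<xi> t) - \<xi> t)) \<le> (L + 1) * D * h" by (simp add: mult.assoc)
  qed (use t in auto)
  moreover have "\<zeta> (t + h) - \<zeta> t = \<xi> (t + h) - (\<xi> t + h *\<^sub>R (F (\<xi> t) - \<xi> t))"
    by (simp add: \<zeta>_def algebra_simps)
  ultimately show ?thesis by (simp add: power2_eq_square mult.assoc)
qed

text \<open>Going back from \<open>n\<close>, the sum of the steps grows by at most one at a time, so it cannot jump over
  the interval from \<open>T\<close> to \<open>T + 1\<close>.\<close>

lemma window_of_given_length:
  fixes a :: "nat \<Rightarrow> real"
  assumes a: "\<And>k. 0 \<le> a k" "\<And>k. a k \<le> 1" and T: "0 \<le> T"
    and long: "T \<le> sum a {K..<n}" and "K \<le> n"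
  obtains k where "K \<le> k" "k \<le> n" "T \<le> sum a {k..<n}" "sum a {k..<n} \<le> T + 1"
proof -
  define k where "k = Max {k \<in> {K..n}. T \<le> sum a {k..<n}}"
  have fin: "finite {k \<in> {K..n}. T \<le> sum a {k..<n}}" by simp
  have "K \<in> {k \<in> {K..n}. T \<le> sum a {k..<n}}" using assms by simp
  then have "k \<in> {k \<in> {K..n}. T \<le> sum a {k..<n}}" unfolding k_def by (intro Max_in fin) blast
  then have k: "K \<le> k" "k \<le> n" "T \<le> sum a {k..<n}" by auto
  have "sum a {k..<n} \<le> T + 1"
  proof (cases "k = n")
    case True
    then show ?thesis using T by simp
  next
    case False
    have "\<not> Suc k \<le> k" by simp
    then have "Suc k \<notin> {k \<in> {K..n}. T \<le> sum a {k..<n}}"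
      unfolding k_def using Max_ge[OF fin] by blast
    then have "sum a {Suc k..<n} < T" using k False by auto
    moreover have "sum a {k..<n} = a k + sum a {Suc k..<n}"
      using k False by (simp add: sum.atLeast_Suc_lessThan)
    ultimately show ?thesis using a(2)[of k] by simp
  qed
  with k show thesis by (rule that)
qed

text \<open>Discrete Gronwall estimate: a step of size \<open>h\<close> magnifies the error by at most \<open>exp ((L + 1) * h)\<close>
  and adds at most \<open>h\<close> times the rate \<open>L * \<omega> + (L + 1) * D * \<alpha>\<close>, in which \<open>\<omega>\<close> accounts for the motion
  of the parameter and \<open>\<alpha>\<close> for the discretization.\<close>

lemma euler_shadows_frozen_flow:
  fixes f :: "'a::euclidean_space \<times> 'b::real_normed_vector \<Rightarrow> 'a"
  assumes f: "f \<in> X \<times> P \<rightarrow> X" "L-lipschitz_on (X \<times> P) f"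
    and diam: "\<And>y z. y \<in> X \<Longrightarrow> z \<in> X \<Longrightarrow> norm (y - z) \<le> D"
    and a: "\<And>j. k \<le> j \<Longrightarrow> 0 \<le> a j" "\<And>j. k \<le> j \<Longrightarrow> a j \<le> \<alpha>"
    and x: "\<And>j. x j \<in> X" "\<And>j. x (Suc j) = x j + a j *\<^sub>R (f (x j, p j) - x j)"
    and p: "\<And>j. p j \<in> P" "\<And>j. k \<le> j \<Longrightarrow> j \<le> n \<Longrightarrow> norm (p j - p k) \<le> \<omega>"
    and \<xi>: "\<xi> 0 = x k" "\<And>t. 0 \<le> t \<Longrightarrow> \<xi> t \<in> X"
      "\<And>t. 0 \<le> t \<Longrightarrow> (\<xi> has_vector_derivative f (\<xi> t, p k) - \<xi> t) (at t within {0..})"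
    and "k \<le> n"
  shows "norm (x n - \<xi> (sum a {k..<n}))
    \<le> exp ((L + 1) * sum a {k..<n}) * (sum a {k..<n} * (L * \<omega> + (L + 1) * D * \<alpha>))"
  using \<open>k \<le> n\<close> p(2)
proof (induction rule: dec_induct)
  case base
  show ?case by (simp add: \<xi>(1))
next
  case (step n)
  let ?E = "L * \<omega> + (L + 1) * D * \<alpha>"
  define h where "h = a n"
  define t where "t = sum a {k..<n}"
  have L: "0 \<le> L" using lipschitz_on_nonneg[OF f(2)] .
  have D: "0 \<le> D" using diam[OF x(1) x(1), of 0 0] by simp
  have h: "0 \<le> h" "h \<le> \<alpha>" using a step.hyps by (auto simp: h_def)
  have t: "0 \<le> t" unfolding t_def using a by (intro sum_nonneg) auto
  have t_Suc: "sum a {k..<Suc n} = t + h" using step.hyps by (simp add: t_def h_def)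
  have \<omega>: "norm (p n - p k) \<le> \<omega>" using step by simp
  then have "0 \<le> \<omega>" using norm_ge_zero order_trans by blast
  then have E: "0 \<le> ?E" using L D h by auto
  have IH: "norm (x n - \<xi> t) \<le> exp ((L + 1) * t) * (t * ?E)"
    using step unfolding t_def by simp
  have lip_frozen: "L-lipschitz_on X (\<lambda>y. f (y, p k))"
  proof (rule lipschitz_onI)
    fix y z assume "y \<in> X" "z \<in> X"
    then show "dist (f (y, p k)) (f (z, p k)) \<le> L * dist y z"
      using lipschitz_onD[OF f(2), of "(y, p k)" "(z, p k)"] p(1) by (simp add: dist_Pair_Pair)
  qed (rule L)
  have euler: "norm (\<xi> (t + h) - (\<xi> t + h *\<^sub>R (f (\<xi> t, p k) - \<xi> t))) \<le> (L + 1) * D * h\<^sup>2"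
    using f(1) p(1) lip_frozen diam \<xi> t h
    by (intro euler_step_error[where X = X and F = "\<lambda>y. f (y, p k)"]) auto
  have "norm (f (x n, p n) - f (\<xi> t, p k)) \<le> L * norm (x n - \<xi> t, p n - p k)"
    using lipschitz_on_normD[OF f(2), of "(x n, p n)" "(\<xi> t, p k)"] x(1) p(1) \<xi>(2)[OF t] by simp
  also have "\<dots> \<le> L * (norm (x n - \<xi> t) + \<omega>)"
    using norm_Pair_le[of "x n - \<xi> t" "p n - p k"] \<omega> L by (intro mult_left_mono) auto
  finally have fdiff: "norm (f (x n, p n) - f (\<xi> t, p k)) \<le> L * (norm (x n - \<xi> t) + \<omega>)" .
  have triangle: "norm (u + v - w - z) \<le> norm u + norm v + norm w + norm z" for u v w z :: 'a
    by norm
  have "x (Suc n) - \<xi> (t + h) = (x n - \<xi> t) + h *\<^sub>R (f (x n, p n) - f (\<xi> t, p k)) - h *\<^sub>R (x n - \<xi> t)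
      - (\<xi> (t + h) - (\<xi> t + h *\<^sub>R (f (\<xi> t, p k) - \<xi> t)))"
    by (simp add: x(2) h_def algebra_simps)
  also have "norm \<dots> \<le> norm (x n - \<xi> t) + norm (h *\<^sub>R (f (x n, p n) - f (\<xi> t, p k)))
      + norm (h *\<^sub>R (x n - \<xi> t)) + norm (\<xi> (t + h) - (\<xi> t + h *\<^sub>R (f (\<xi> t, p k) - \<xi> t)))"
    by (rule triangle)
  also have "\<dots> \<le> norm (x n - \<xi> t) + h * (L * (norm (x n - \<xi> t) + \<omega>))
      + h * norm (x n - \<xi> t) + (L + 1) * D * h\<^sup>2"
    using fdiff euler h by (intro add_mono) (auto intro: mult_left_mono)
  also have "\<dots> = (1 + (L + 1) * h) * norm (x n - \<xi> t) + h * (L * \<omega> + (L + 1) * D * h)"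
    by (simp add: algebra_simps power2_eq_square)
  also have "\<dots> \<le> exp ((L + 1) * h) * (exp ((L + 1) * t) * (t * ?E)) + exp ((L + 1) * (t + h)) * (h * ?E)"
  proof (intro add_mono)
    show "(1 + (L + 1) * h) * norm (x n - \<xi> t) \<le> exp ((L + 1) * h) * (exp ((L + 1) * t) * (t * ?E))"
      using IH exp_ge_add_one_self[of "(L + 1) * h"] L h by (intro mult_mono) auto
    have "h * (L * \<omega> + (L + 1) * D * h) \<le> 1 * (h * ?E)"
      using h L D by (auto intro!: mult_left_mono add_left_mono)
    also have "\<dots> \<le> exp ((L + 1) * (t + h)) * (h * ?E)"
      using h L E t by (intro mult_right_mono) auto
    finally show "h * (L * \<omega> + (L + 1) * D * h) \<le> exp ((L + 1) * (t + h)) * (h * ?E)" .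
  qed
  also have "\<dots> = exp ((L + 1) * (t + h)) * ((t + h) * ?E)"
    by (simp add: algebra_simps exp_add)
  finally show ?case unfolding t_Suc .
qed

lemma slow_parameter_drift:
  fixes p :: "nat \<Rightarrow> 'b::real_normed_vector"
  assumes step: "\<And>j. norm (p (Suc j) - p j) \<le> B * \<beta> j" and "0 \<le> B"
    and slow: "\<And>j. k \<le> j \<Longrightarrow> \<beta> j \<le> \<delta> * a j" and "k \<le> n"
  shows "norm (p n - p k) \<le> B * \<delta> * sum a {k..<n}"
  using \<open>k \<le> n\<close>
proof (induction rule: dec_induct)
  case base
  show ?case by simp
next
  case (step n)
  have "norm (p (Suc n) - p k) \<le> norm (p (Suc n) - p n) + norm (p n - p k)" by norm
  also have "norm (p (Suc n) - p n) \<le> B * (\<delta> * a n)"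
    using assms(1)[of n] mult_left_mono[OF slow[OF step.hyps(1)] \<open>0 \<le> B\<close>] by simp
  finally show ?case using step by (simp add: algebra_simps)
qed

text \<open>The first term of \<open>x n - R (p n) = (x n - \<xi> t) + (\<xi> t - R (p k)) + (R (p k) - R (p n))\<close> is the
  shadowing error on a window from \<open>k\<close> to \<open>n\<close> of length \<open>t\<close> between \<open>T\<close> and \<open>T + 1\<close>, the second is
  small because \<open>T\<close> is a settling time of the flow, and the third because the parameter hardly moves
  on the window.\<close>

lemma fast_iterate_tracks_response:
  fixes f :: "'a::euclidean_space \<times> 'b::real_normed_vector \<Rightarrow> 'a"
  assumes X: "compact X" "convex X"
    and f: "f \<in> X \<times> P \<rightarrow> X" "L-lipschitz_on (X \<times> P) f"
    and R: "\<rho>-lipschitz_on P R"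
    and attracting: "\<And>\<epsilon>. 0 < \<epsilon> \<Longrightarrow> \<exists>T\<ge>0. \<forall>q\<in>P. \<forall>\<xi> :: real \<Rightarrow> 'a.
        (\<forall>t\<ge>0. \<xi> t \<in> X \<and> (\<xi> has_vector_derivative f (\<xi> t, q) - \<xi> t) (at t within {0..})) \<longrightarrow>
        (\<forall>t\<ge>T. norm (\<xi> t - R q) \<le> \<epsilon>)"
    and a: "\<And>k. 0 < a k" "\<And>k. a k \<le> 1" "a \<longlonglongrightarrow> 0"
      "filterlim (\<lambda>n. \<Sum>k<n. a k) at_top sequentially"
    and ratio: "(\<lambda>k. \<beta> k / a k) \<longlonglongrightarrow> 0"
    and x: "\<And>k. x k \<in> X" "\<And>k. x (Suc k) = x k + a k *\<^sub>R (f (x k, p k) - x k)"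
    and p: "\<And>k. p k \<in> P" "\<And>k. norm (p (Suc k) - p k) \<le> B * \<beta> k" "0 \<le> B"
  shows "(\<lambda>k. norm (x k - R (p k))) \<longlonglongrightarrow> 0"
proof (rule LIMSEQ_I)
  fix \<epsilon> :: real assume \<epsilon>: "0 < \<epsilon>"
  obtain D where D: "norm (y - z) \<le> D" if "y \<in> X" "z \<in> X" for y z
    using compact_imp_bounded[OF X(1)] by (metis diameter_bounded_bound dist_norm)
  have L: "0 \<le> L" using lipschitz_on_nonneg[OF f(2)] .
  have D0: "0 \<le> D" using D[OF x(1) x(1), of 0 0] by simp
  have \<rho>: "0 \<le> \<rho>" using lipschitz_on_nonneg[OF R] .
  obtain T where T: "0 \<le> T" and attract: "\<And>q \<xi> t. q \<in> P \<Longrightarrow>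
      (\<And>t. 0 \<le> t \<Longrightarrow> \<xi> t \<in> X) \<Longrightarrow>
      (\<And>t. 0 \<le> t \<Longrightarrow> (\<xi> has_vector_derivative f (\<xi> t, q) - \<xi> t) (at t within {0..})) \<Longrightarrow>
      T \<le> t \<Longrightarrow> norm (\<xi> t - R q) \<le> \<epsilon> / 4"
    using attracting[of "\<epsilon> / 4"] \<epsilon> by (metis divide_pos_pos zero_less_numeral)
  \<comment> \<open>with all steps and all ratios \<open>\<beta> / a\<close> below \<open>\<delta>\<close>, the shadowing error is at most \<open>C * \<delta>\<close>
    and the drift of the response at most \<open>C' * \<delta>\<close>\<close>
  define C where "C = exp ((L + 1) * (T + 1)) * ((T + 1) * (L * (B * (T + 1)) + (L + 1) * D))"
  define C' where "C' = \<rho> * (B * (T + 1))"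
  have C: "0 \<le> C" "0 \<le> C'" using L D0 T p(3) \<rho> by (auto simp: C_def C'_def)
  define \<delta> where "\<delta> = \<epsilon> / 4 / (C + C' + 1)"
  have \<delta>: "0 < \<delta>" using \<epsilon> C by (simp add: \<delta>_def)
  have "(C + C') * \<delta> \<le> (C + C' + 1) * \<delta>" using \<delta> by (simp add: algebra_simps)
  also have "\<dots> = \<epsilon> / 4"
  proof -
    have "C + C' + 1 \<noteq> 0" using C by linarith
    then show ?thesis unfolding \<delta>_def by (metis nonzero_mult_div_cancel_left times_divide_eq_right)
  qed
  finally have \<delta>_small: "(C + C') * \<delta> \<le> \<epsilon> / 4" .
  have "\<forall>\<^sub>F k in sequentially. a k < \<delta> \<and> \<beta> k / a k < \<delta>"
    using order_tendstoD(2)[OF a(3) \<delta>] order_tendstoD(2)[OF ratio \<delta>] by eventually_elim auto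
  then obtain K where K: "a k < \<delta>" "\<beta> k / a k < \<delta>" if "K \<le> k" for k
    by (auto simp: eventually_sequentially)
  have slow: "\<beta> k \<le> \<delta> * a k" if "K \<le> k" for k
    using K(2)[OF that] a(1)[of k] by (simp add: field_simps)
  have "\<forall>\<^sub>F n in sequentially. T + sum a {..<K} \<le> (\<Sum>k<n. a k)"
    using a(4) by (simp add: filterlim_at_top)
  then obtain N where N: "T + sum a {..<K} \<le> (\<Sum>k<n. a k)" if "N \<le> n" for n
    by (auto simp: eventually_sequentially)
  show "\<exists>N. \<forall>n\<ge>N. norm (norm (x n - R (p n)) - 0) < \<epsilon>"
  proof (intro exI allI impI)
    fix n assume n: "max N K \<le> n"
    have "sum a {..<n} = sum a {..<K} + sum a {K..<n}"
      using n sum.atLeastLessThan_concat[of 0 K n a] by (simp add: atLeast0LessThan)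
    then have "T \<le> sum a {K..<n}" using N[of n] n by simp
    then obtain k where k: "K \<le> k" "k \<le> n" "T \<le> sum a {k..<n}" "sum a {k..<n} \<le> T + 1"
      using window_of_given_length[of a T K n] a(1,2) T n by (metis less_imp_le max.bounded_iff)
    define t where "t = sum a {k..<n}"
    have t: "0 \<le> t" "T \<le> t" "t \<le> T + 1" using k T by (auto simp: t_def)
    have drift: "norm (p j - p k) \<le> B * \<delta> * (T + 1)" if "k \<le> j" "j \<le> n" for j
    proof -
      have "norm (p j - p k) \<le> B * \<delta> * sum a {k..<j}"
        using p slow k that by (intro slow_parameter_drift[where \<beta> = \<beta>]) auto
      also have "sum a {k..<j} \<le> sum a {k..<n}"
        using that a(1) by (intro sum_mono2) (auto intro: less_imp_le)
      then have "B * \<delta> * sum a {k..<j} \<le> B * \<delta> * (T + 1)"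
        using k p(3) \<delta> by (intro mult_left_mono) auto
      finally show ?thesis .
    qed
    have "(\<lambda>y. f (y, p k)) \<in> X \<rightarrow> X" using f(1) p(1) by auto
    moreover have "L-lipschitz_on X (\<lambda>y. f (y, p k))"
      using lipschitz_onD[OF f(2), of "(_, p k)" "(_, p k)"] p(1) L
      by (intro lipschitz_onI) (auto simp: dist_Pair_Pair)
    ultimately obtain \<xi> where \<xi>: "\<xi> 0 = x k" "\<And>t. 0 \<le> t \<Longrightarrow> \<xi> t \<in> X"
        "\<And>t. 0 \<le> t \<Longrightarrow> (\<xi> has_vector_derivative f (\<xi> t, p k) - \<xi> t) (at t within {0..})"
      by (rule relaxation_flow_exists[OF X(2) compact_imp_closed[OF X(1)] x(1)[of k]]) blast
    let ?E = "L * (B * \<delta> * (T + 1)) + (L + 1) * D * \<delta>"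
    have E: "0 \<le> ?E" using L p(3) \<delta> T D0 by auto
    have "norm (x n - \<xi> t) \<le> exp ((L + 1) * t) * (t * ?E)"
      unfolding t_def
    proof (rule euler_shadows_frozen_flow[OF f D])
      show "a j \<le> \<delta>" if "k \<le> j" for j using K(1)[of j] k that by simp
    qed (use x p(1) \<xi> drift k a(1) in \<open>auto intro: less_imp_le\<close>)
    also have "\<dots> \<le> exp ((L + 1) * (T + 1)) * ((T + 1) * ?E)"
      using t L E by (intro mult_mono) auto
    also have "\<dots> = C * \<delta>" by (simp add: C_def algebra_simps)
    finally have shadow: "norm (x n - \<xi> t) \<le> C * \<delta>" .
    have settled: "norm (\<xi> t - R (p k)) \<le> \<epsilon> / 4"
      using attract[OF p(1) \<xi>(2,3)] t by blast
    have "norm (R (p n) - R (p k)) \<le> \<rho> * norm (p n - p k)"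
      using lipschitz_on_normD[OF R] p(1) by blast
    also have "\<dots> \<le> \<rho> * (B * \<delta> * (T + 1))"
      using drift[of n] k \<rho> by (intro mult_left_mono) auto
    finally have "norm (R (p n) - R (p k)) \<le> C' * \<delta>" by (simp add: C'_def mult_ac)
    moreover have "norm (x n - R (p n)) \<le> norm (x n - \<xi> t) + norm (\<xi> t - R (p k)) + norm (R (p n) - R (p k))"
      by norm
    ultimately have "norm (x n - R (p n)) \<le> (C + C') * \<delta> + \<epsilon> / 4"
      using shadow settled by (simp add: algebra_simps)
    then show "norm (norm (x n - R (p n)) - 0) < \<epsilon>" using \<delta>_small \<epsilon> by simp
  qed
qed


section \<open>Contraction of the objective gap under incentive updates\<close>

text \<open>Once \<open>\<eta> \<le> \<epsilon> / 2\<close>, the excess of \<open>v\<close> over \<open>\<epsilon> / 2\<close> is multiplied by at most \<open>1 - b k \<le> exp (- b k)\<close>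
  in each step, and \<open>\<Sum>b = \<infinity>\<close> makes the product of these factors vanish.\<close>

lemma perturbed_contraction_tendsto_zero:
  fixes v b \<eta> :: "nat \<Rightarrow> real"
  assumes v: "\<And>k. 0 \<le> v k" and b: "\<And>k. 0 \<le> b k"
    and diverge: "filterlim (\<lambda>n. \<Sum>k<n. b k) at_top sequentially"
    and \<eta>: "\<eta> \<longlonglongrightarrow> 0"
    and step: "\<forall>\<^sub>F k in sequentially. b k \<le> 1 \<and> v (Suc k) \<le> (1 - b k) * v k + b k * \<eta> k"
  shows "v \<longlonglongrightarrow> 0"
proof (rule LIMSEQ_I)
  fix \<epsilon> :: real assume \<epsilon>: "0 < \<epsilon>"
  then have "\<forall>\<^sub>F k in sequentially. \<eta> k < \<epsilon> / 2"
    by (intro order_tendstoD(2)[OF \<eta>]) simp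
  with step have "\<forall>\<^sub>F k in sequentially. b k \<le> 1 \<and> v (Suc k) - \<epsilon> / 2 \<le> (1 - b k) * (v k - \<epsilon> / 2)"
  proof eventually_elim
    case (elim k)
    have "b k * \<eta> k \<le> b k * (\<epsilon> / 2)" using elim b[of k] by (intro mult_left_mono) auto
    then have "b k * \<eta> k \<le> b k * \<epsilon> / 2" by simp
    then show ?case using elim by (simp add: left_diff_distrib right_diff_distrib diff_divide_distrib)
  qed
  then obtain K where K: "b k \<le> 1" "v (Suc k) - \<epsilon> / 2 \<le> (1 - b k) * (v k - \<epsilon> / 2)" if "K \<le> k" for k
    by (auto simp: eventually_sequentially)
  have decay: "v n - \<epsilon> / 2 \<le> v K * exp (- sum b {K..<n})" if "K \<le> n" for n
    using that
  proof (induction rule: dec_induct)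
    case base
    then show ?case using \<epsilon> by simp
  next
    case (step n)
    have "v (Suc n) - \<epsilon> / 2 \<le> (1 - b n) * (v n - \<epsilon> / 2)" using K(2) step by simp
    also have "\<dots> \<le> (1 - b n) * (v K * exp (- sum b {K..<n}))"
      using K(1) step by (intro mult_left_mono) auto
    also have "\<dots> \<le> exp (- b n) * (v K * exp (- sum b {K..<n}))"
      using exp_ge_add_one_self[of "- b n"] v by (intro mult_right_mono) auto
    also have "\<dots> = v K * exp (- sum b {K..<Suc n})"
      using step by (simp add: exp_add algebra_simps exp_diff exp_minus divide_simps)
    finally show ?case .
  qed
  have "filterlim (\<lambda>n. - sum b {..<K} + (\<Sum>k<n. b k)) at_top sequentially"
    using diverge by (rule filterlim_tendsto_add_at_top[OF tendsto_const])
  moreover have "\<forall>\<^sub>F n in sequentially. - sum b {..<K} + (\<Sum>k<n. b k) = sum b {K..<n}"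
    using eventually_ge_at_top[of K]
  proof eventually_elim
    case (elim n)
    then show ?case
      using sum.atLeastLessThan_concat[of 0 K n b] by (simp add: atLeast0LessThan)
  qed
  ultimately have "filterlim (\<lambda>n. sum b {K..<n}) at_top sequentially"
    by (simp cong: filterlim_cong)
  then have "(\<lambda>n. exp (- sum b {K..<n})) \<longlonglongrightarrow> 0"
    by (intro filterlim_compose[OF exp_at_bot]) (simp add: filterlim_uminus_at_bot)
  then have "(\<lambda>n. v K * exp (- sum b {K..<n})) \<longlonglongrightarrow> 0"
    by (rule tendsto_mult_right_zero)
  then have "\<forall>\<^sub>F n in sequentially. v K * exp (- sum b {K..<n}) < \<epsilon> / 2"
    using order_tendstoD(2) \<epsilon> half_gt_zero by blast
  then have "\<forall>\<^sub>F n in sequentially. norm (v n - 0) < \<epsilon>"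
    using eventually_ge_at_top[of K]
  proof eventually_elim
    case (elim n)
    then show ?case using decay[of n] v[of n] by simp
  qed
  then show "\<exists>N. \<forall>n\<ge>N. norm (v n - 0) < \<epsilon>" by (simp add: eventually_sequentially)
qed

text \<open>The Polyak-Lojasiewicz inequality: the quadratic lower bound at \<open>y\<close> is minimized over \<open>z\<close> by
  \<open>\<mu> *\<^sub>R (z - y) = - g\<close>, which is the square completed in the proof.\<close>

lemma gradient_dominates_gap:
  fixes \<Phi> :: "'a::real_inner \<Rightarrow> real"
  assumes "0 < \<mu>" and convex: "\<Phi> z \<ge> \<Phi> y + g \<bullet> (z - y) + \<mu> / 2 * (norm (z - y))\<^sup>2"
  shows "2 * \<mu> * (\<Phi> y - \<Phi> z) \<le> (norm g)\<^sup>2"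
proof -
  have "0 \<le> (norm (g + \<mu> *\<^sub>R (z - y)))\<^sup>2" by simp
  also have "\<dots> = (norm g)\<^sup>2 + 2 * \<mu> * (g \<bullet> (z - y)) + \<mu>\<^sup>2 * (norm (z - y))\<^sup>2"
    by (simp only: power2_norm_eq_inner)
      (simp add: inner_add_left inner_add_right inner_commute power2_eq_square)
  also have "\<dots> = (norm g)\<^sup>2 + 2 * \<mu> * (g \<bullet> (z - y) + \<mu> / 2 * (norm (z - y))\<^sup>2)"
    by (simp add: algebra_simps power2_eq_square)
  also have "\<dots> \<le> (norm g)\<^sup>2 + 2 * \<mu> * (\<Phi> z - \<Phi> y)"
    using assms by (intro add_left_mono mult_left_mono) auto
  finally show ?thesis by (simp add: algebra_simps)
qed

text \<open>Write \<open>d = z - y\<close>. Strong monotonicity gives \<open>\<beta> * (g x \<bullet> d) \<le> - m * |d|\<^sup>2\<close>, and the Lipschitz bound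
  on \<open>G\<close> gives \<open>\<beta> * |g x| \<le> \<Lambda> * |d|\<close>; together, \<open>d\<close> is a descent direction with
  \<open>g x \<bullet> d \<le> - (m / \<Lambda>\<^sup>2) * \<beta> * |g x|\<^sup>2\<close>. The gradient is read at \<open>x\<close> instead of the response \<open>y\<close>; by
  its Lipschitz continuity this costs a multiple of \<open>|x - y|\<close>. Convexity is used from \<open>z\<close> towards
  \<open>y\<close>, since this direction bounds \<open>\<Phi> z - \<Phi> y\<close> from above, by \<open>g z \<bullet> d\<close>.\<close>

lemma inexact_dual_step_decrease:
  fixes G g :: "'a::real_inner \<Rightarrow> 'a" and \<Phi> :: "'a \<Rightarrow> real"
  assumes "0 < \<mu>" and convex: "\<And>y z. y \<in> X \<Longrightarrow> z \<in> X \<Longrightarrow> \<Phi> z \<ge> \<Phi> y + g y \<bullet> (z - y) + \<mu> / 2 * (norm (z - y))\<^sup>2"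
    and g: "L-lipschitz_on X g" "\<And>y. y \<in> X \<Longrightarrow> norm (g y) \<le> B"
    and "0 < m" and mono: "\<And>y z. y \<in> X \<Longrightarrow> z \<in> X \<Longrightarrow> m * (norm (y - z))\<^sup>2 \<le> (G y - G z) \<bullet> (y - z)"
    and G: "\<Lambda>-lipschitz_on X G" "0 < \<Lambda>"
    and X: "x\<^sub>d \<in> X" "x \<in> X" "y \<in> X" "z \<in> X"
    and "0 < \<beta>" and step: "G z = G y - \<beta> *\<^sub>R g x"
  shows "\<Phi> z - \<Phi> x\<^sub>d \<le> (1 - 2 * m * \<mu> / \<Lambda>\<^sup>2 * \<beta>) * (\<Phi> y - \<Phi> x\<^sub>d)
    + \<beta> * (L * B * (2 * m / \<Lambda>\<^sup>2 + 1 / m + B / m\<^sup>2) * (norm (x - y) + \<beta>))"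
proof -
  define d where "d = z - y"
  define e where "e = norm (x - y)"
  have L: "0 \<le> L" using lipschitz_on_nonneg[OF g(1)] .
  have B: "0 \<le> B" using g(2)[OF X(1)] norm_ge_zero order_trans by blast
  have e: "0 \<le> e" by (simp add: e_def)
  have descent: "m * (norm d)\<^sup>2 \<le> - \<beta> * (g x \<bullet> d)"
    using mono[OF X(4,3)] by (simp add: step d_def)
  have "m * (norm d)\<^sup>2 \<le> \<beta> * (B * norm d)"
  proof -
    have "- (g x \<bullet> d) \<le> B * norm d"
      using norm_cauchy_schwarz[of "- g x" d] mult_right_mono[OF g(2)[OF X(2)] norm_ge_zero[of d]] by simp
    then show ?thesis using descent mult_left_mono[of "- (g x \<bullet> d)" "B * norm d" \<beta>] \<open>0 < \<beta>\<close> by simp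
  qed
  then have d: "norm d \<le> \<beta> * B / m"
    using \<open>0 < m\<close> \<open>0 < \<beta>\<close> B by (cases "norm d = 0") (auto simp: power2_eq_square field_simps)
  have "\<beta> * norm (g x) \<le> \<Lambda> * norm d"
    using lipschitz_on_normD[OF G(1) X(4,3)] \<open>0 < \<beta>\<close> by (simp add: step d_def)
  then have "(\<beta> * norm (g x))\<^sup>2 \<le> (\<Lambda> * norm d)\<^sup>2"
    using \<open>0 < \<beta>\<close> by (intro power_mono) auto
  then have "m / \<Lambda>\<^sup>2 * (\<beta> * norm (g x))\<^sup>2 \<le> m / \<Lambda>\<^sup>2 * (\<Lambda> * norm d)\<^sup>2"
    using \<open>0 < m\<close> by (intro mult_left_mono) auto
  also have "\<dots> = m * (norm d)\<^sup>2" using G(2) by (simp add: power_mult_distrib)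
  also note descent
  finally have "\<beta> * (m / \<Lambda>\<^sup>2 * \<beta> * (norm (g x))\<^sup>2) \<le> \<beta> * (- (g x \<bullet> d))"
    by (simp add: power2_eq_square mult_ac)
  then have gd: "g x \<bullet> d \<le> - (m / \<Lambda>\<^sup>2 * \<beta> * (norm (g x))\<^sup>2)"
    using \<open>0 < \<beta>\<close> by (simp only: mult_le_cancel_left_pos)
  have gap: "2 * \<mu> * (\<Phi> y - \<Phi> x\<^sub>d) - 2 * B * L * e \<le> (norm (g x))\<^sup>2"
  proof -
    have "norm (g y) - norm (g x) \<le> L * e"
      using lipschitz_on_normD[OF g(1) X(3,2)] norm_triangle_ineq2[of "g y" "g x"]
      by (simp add: e_def norm_minus_commute)
    then have "(norm (g y) - norm (g x)) * (norm (g y) + norm (g x)) \<le> (L * e) * (norm (g y) + norm (g x))"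
      by (intro mult_right_mono) auto
    also have "\<dots> \<le> (L * e) * (B + B)"
      using L e g(2) X by (intro mult_left_mono add_mono) auto
    finally have "(norm (g y))\<^sup>2 - (norm (g x))\<^sup>2 \<le> 2 * B * L * e"
      by (simp add: power2_eq_square algebra_simps)
    then show ?thesis
      using gradient_dominates_gap[where \<Phi> = \<Phi>, OF \<open>0 < \<mu>\<close> convex[OF X(3,1)]] by simp
  qed
  have "\<Phi> z - \<Phi> y \<le> g z \<bullet> d"
    using convex[OF X(4,3)] \<open>0 < \<mu>\<close>
    by (smt (verit, best) d_def inner_minus_right minus_diff_eq mult_nonneg_nonneg zero_le_power2 divide_nonneg_pos)
  also have "\<dots> = g x \<bullet> d + (g z - g x) \<bullet> d" by (simp add: inner_diff_left)
  also have "(g z - g x) \<bullet> d \<le> (L * (\<beta> * B / m + e)) * (\<beta> * B / m)"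
  proof -
    have "norm (g z - g x) \<le> L * norm (z - x)" by (rule lipschitz_on_normD[OF g(1) X(4,2)])
    also have "norm (z - x) \<le> norm d + e"
      using norm_triangle_ineq[of d "y - x"] by (simp add: d_def e_def norm_minus_commute)
    also have "norm d + e \<le> \<beta> * B / m + e" using d by simp
    finally have "norm (g z - g x) \<le> L * (\<beta> * B / m + e)" using L by (simp add: mult_left_mono)
    then have "norm (g z - g x) * norm d \<le> (L * (\<beta> * B / m + e)) * (\<beta> * B / m)"
      using d L B e \<open>0 < m\<close> \<open>0 < \<beta>\<close> by (intro mult_mono) auto
    then show ?thesis using norm_cauchy_schwarz[of "g z - g x" d] by linarith
  qed
  also note gd
  also have "- (m / \<Lambda>\<^sup>2 * \<beta> * (norm (g x))\<^sup>2) \<le> - (m / \<Lambda>\<^sup>2 * \<beta> * (2 * \<mu> * (\<Phi> y - \<Phi> x\<^sub>d) - 2 * B * L * e))"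
    using gap \<open>0 < m\<close> \<open>0 < \<beta>\<close> by (intro le_imp_neg_le mult_left_mono) auto
  finally have "\<Phi> z - \<Phi> y \<le> - (m / \<Lambda>\<^sup>2 * \<beta> * (2 * \<mu> * (\<Phi> y - \<Phi> x\<^sub>d) - 2 * B * L * e))
      + (L * (\<beta> * B / m + e)) * (\<beta> * B / m)" by simp
  then have "\<Phi> z - \<Phi> x\<^sub>d \<le> (1 - 2 * m * \<mu> / \<Lambda>\<^sup>2 * \<beta>) * (\<Phi> y - \<Phi> x\<^sub>d)
      + \<beta> * (L * B * ((2 * m / \<Lambda>\<^sup>2 + 1 / m) * e + B / m\<^sup>2 * \<beta>))"
    by (simp add: algebra_simps diff_divide_distrib power2_eq_square)
  also have "(2 * m / \<Lambda>\<^sup>2 + 1 / m) * e + B / m\<^sup>2 * \<beta> \<le> (2 * m / \<Lambda>\<^sup>2 + 1 / m + B / m\<^sup>2) * (e + \<beta>)"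
  proof -
    have "0 \<le> (2 * m / \<Lambda>\<^sup>2 + 1 / m) * \<beta> + B / m\<^sup>2 * e"
      using \<open>0 < m\<close> \<open>0 < \<beta>\<close> B e by simp
    then show ?thesis by (simp add: algebra_simps add_divide_distrib)
  qed
  finally show ?thesis
    using \<open>0 < \<beta>\<close> L B by (simp add: e_def mult_left_mono mult.assoc)
qed

text \<open>Only the tail of the sequence matters, and there the guard is always passed: \<open>K\<close> is a compact part of
  the interior of \<open>X\<close>, so its image under \<open>- G\<close> has positive distance to the complement of the open
  image of the interior, and a short step from \<open>p k\<close> leads to some \<open>- G z\<close> with \<open>z\<close> interior. The
  perturbed contraction bounds the gap at \<open>z\<close> by a convex combination of the gap at \<open>y k\<close> and the
  error \<open>\<eta> k\<close>, both at most \<open>c\<close>, hence \<open>z \<in> K\<close>.\<close>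

lemma guarded_incentive_response_converges:
  fixes G g :: "'a::euclidean_space \<Rightarrow> 'a" and \<Phi> :: "'a \<Rightarrow> real"
  assumes X: "compact X"
    and "0 < \<mu>" and convex: "\<And>y z. y \<in> X \<Longrightarrow> z \<in> X \<Longrightarrow> \<Phi> z \<ge> \<Phi> y + g y \<bullet> (z - y) + \<mu> / 2 * (norm (z - y))\<^sup>2"
    and \<Phi>: "continuous_on X \<Phi>" and g: "L-lipschitz_on X g"
    and x\<^sub>d: "x\<^sub>d \<in> X" "\<And>y. y \<in> X \<Longrightarrow> \<mu> / 2 * (norm (y - x\<^sub>d))\<^sup>2 \<le> \<Phi> y - \<Phi> x\<^sub>d"
    and "0 < m" and mono: "\<And>y z. y \<in> X \<Longrightarrow> z \<in> X \<Longrightarrow> m * (norm (y - z))\<^sup>2 \<le> (G y - G z) \<bullet> (y - z)"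
    and G: "\<Lambda>-lipschitz_on X G" "0 < \<Lambda>"
    and "0 < c" and K: "K = {y \<in> X. \<Phi> y - \<Phi> x\<^sub>d \<le> c}" "K \<subseteq> interior X"
    and \<beta>: "\<And>k. 0 < \<beta> k" "\<beta> \<longlonglongrightarrow> 0" "filterlim (\<lambda>n. \<Sum>k<n. \<beta> k) at_top sequentially"
    and y: "\<And>k. y k \<in> K" "\<And>k. p k = - G (y k)"
    and x: "\<And>k. x k \<in> X" "(\<lambda>k. norm (x k - y k)) \<longlonglongrightarrow> 0"
    and step: "\<And>k. p (Suc k) = p k +
      (\<beta> k * indicat_real ((\<lambda>y. - G y) ` K) (p k + \<beta> k *\<^sub>R g (x k))) *\<^sub>R g (x k)"
  shows "y \<longlonglongrightarrow> x\<^sub>d"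
proof -
  have KX: "K \<subseteq> X" using K(1) by auto
  have contG: "continuous_on T (\<lambda>y. - G y)" if "T \<subseteq> X" for T
    using that by (intro continuous_intros lipschitz_on_continuous_on[OF lipschitz_on_subset[OF G(1)]])
  have injG: "inj_on G X"
  proof (rule inj_onI)
    fix y z assume "y \<in> X" "z \<in> X" "G y = G z"
    then have "m * (norm (y - z))\<^sup>2 \<le> 0" using mono[of y z] by simp
    then show "y = z" using \<open>0 < m\<close> by (simp add: mult_le_0_iff)
  qed
  have "compact (g ` X)" using compact_continuous_image lipschitz_on_continuous_on[OF g] X by blast
  then obtain B where B: "norm (g y) \<le> B" if "y \<in> X" for y
    using compact_imp_bounded bounded_iff by (metis imageI)
  have K_closed: "K = X \<inter> \<Phi> -` {..\<Phi> x\<^sub>d + c}" using K(1) by auto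
  have "closed K"
    unfolding K_closed using compact_imp_closed[OF X] by (intro continuous_closed_preimage \<Phi>) auto
  then have "compact K" using X KX by (metis compact_Int_closed inf.absorb_iff2)
  then have "compact ((\<lambda>y. - G y) ` K)" by (intro compact_continuous_image contG KX)
  moreover have "open ((\<lambda>y. - G y) ` interior X)"
    using inj_on_subset[OF injG interior_subset] interior_subset
    by (intro invariance_of_domain contG) (auto simp: inj_on_def)
  moreover have "(\<lambda>y. - G y) ` K \<subseteq> (\<lambda>y. - G y) ` interior X" using K(2) by auto
  ultimately obtain \<epsilon> where \<epsilon>: "0 < \<epsilon>" "(\<Union>q\<in>(\<lambda>y. - G y) ` K. ball q \<epsilon>) \<subseteq> (\<lambda>y. - G y) ` interior X"
    by (rule compact_subset_open_imp_ball_epsilon_subset)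
  define v where "v k = \<Phi> (y k) - \<Phi> x\<^sub>d" for k
  define \<kappa> where "\<kappa> = 2 * m * \<mu> / \<Lambda>\<^sup>2"
  define C where "C = L * B * (2 * m / \<Lambda>\<^sup>2 + 1 / m + B / m\<^sup>2)"
  \<comment> \<open>the division by \<open>\<kappa>\<close> turns the error into the second term of a convex combination with weight \<open>\<kappa> * \<beta> k\<close>\<close>
  define \<eta> where "\<eta> k = C / \<kappa> * (norm (x k - y k) + \<beta> k)" for k
  have \<kappa>: "0 < \<kappa>" using \<open>0 < m\<close> \<open>0 < \<mu>\<close> G(2) by (simp add: \<kappa>_def)
  have "\<eta> \<longlonglongrightarrow> 0"
    unfolding \<eta>_def using tendsto_mult_right_zero[OF tendsto_add_zero[OF x(2) \<beta>(2)]] .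
  have v_nonneg: "0 \<le> v k" for k
  proof -
    have "0 \<le> \<mu> / 2 * (norm (y k - x\<^sub>d))\<^sup>2" using \<open>0 < \<mu>\<close> by simp
    then show ?thesis using x\<^sub>d(2)[of "y k"] y(1)[of k] KX unfolding v_def by auto
  qed
  have "\<forall>\<^sub>F k in sequentially. \<beta> k * B < \<epsilon>"
    using order_tendstoD(2)[OF tendsto_mult_left_zero[OF \<beta>(2)] \<epsilon>(1)] .
  moreover have "\<forall>\<^sub>F k in sequentially. \<kappa> * \<beta> k < 1"
    using order_tendstoD(2)[OF tendsto_mult_right_zero[OF \<beta>(2)] zero_less_one] .
  moreover have "\<forall>\<^sub>F k in sequentially. \<eta> k < c"
    using order_tendstoD(2)[OF \<open>\<eta> \<longlonglongrightarrow> 0\<close> \<open>0 < c\<close>] .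
  ultimately have "\<forall>\<^sub>F k in sequentially. \<kappa> * \<beta> k \<le> 1 \<and> v (Suc k) \<le> (1 - \<kappa> * \<beta> k) * v k + \<kappa> * \<beta> k * \<eta> k"
  proof eventually_elim
    case (elim k)
    have yk: "y k \<in> X" "v k \<le> c" using y(1)[of k] K(1) by (auto simp: v_def)
    have "norm (\<beta> k *\<^sub>R g (x k)) \<le> \<beta> k * B" using \<beta>(1)[of k] B[OF x(1)[of k]] by simp
    then have "p k + \<beta> k *\<^sub>R g (x k) \<in> ball (p k) \<epsilon>" using elim(1) by (simp add: dist_norm)
    moreover have "p k \<in> (\<lambda>y. - G y) ` K" using y by auto
    ultimately have "p k + \<beta> k *\<^sub>R g (x k) \<in> (\<lambda>y. - G y) ` interior X" using \<epsilon>(2) by blast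
    then obtain z where z: "z \<in> interior X" "p k + \<beta> k *\<^sub>R g (x k) = - G z" by auto
    then have zX: "z \<in> X" using interior_subset by blast
    have "G z = G (y k) - \<beta> k *\<^sub>R g (x k)" using z(2) y(2)[of k] by (simp add: algebra_simps eq_neg_iff_add_eq_0)
    then have "\<Phi> z - \<Phi> x\<^sub>d \<le> (1 - \<kappa> * \<beta> k) * v k + \<beta> k * (C * (norm (x k - y k) + \<beta> k))"
      unfolding v_def \<kappa>_def C_def
      using inexact_dual_step_decrease[OF \<open>0 < \<mu>\<close> convex g B \<open>0 < m\<close> mono G x\<^sub>d(1) x(1) yk(1) zX \<beta>(1)]
      by blast
    also have "\<beta> k * (C * (norm (x k - y k) + \<beta> k)) = \<kappa> * \<beta> k * \<eta> k" using \<kappa> by (simp add: \<eta>_def)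
    finally have vz: "\<Phi> z - \<Phi> x\<^sub>d \<le> (1 - \<kappa> * \<beta> k) * v k + \<kappa> * \<beta> k * \<eta> k" .
    also have "\<dots> \<le> (1 - \<kappa> * \<beta> k) * c + \<kappa> * \<beta> k * c"
      using elim yk \<kappa> \<beta>(1)[of k] by (intro add_mono mult_left_mono) auto
    finally have "z \<in> K" using zX K(1) by (simp add: algebra_simps)
    then have "p k + \<beta> k *\<^sub>R g (x k) \<in> (\<lambda>y. - G y) ` K" using z(2) by simp
    then have "p (Suc k) = - G z" using step[of k] z(2) by simp
    then have "y (Suc k) = z" using y(2)[of "Suc k"] y(1)[of "Suc k"] KX zX inj_onD[OF injG] by auto
    then show ?case using vz elim(2) by (simp add: v_def)
  qed
  moreover have "filterlim (\<lambda>n. \<Sum>k<n. \<kappa> * \<beta> k) at_top sequentially"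
    using filterlim_tendsto_pos_mult_at_top[OF tendsto_const \<kappa> \<beta>(3)] by (simp add: sum_distrib_left)
  moreover have "0 \<le> \<kappa> * \<beta> k" for k using \<kappa> \<beta>(1)[of k] by simp
  ultimately have v0: "v \<longlonglongrightarrow> 0"
    using v_nonneg \<open>\<eta> \<longlonglongrightarrow> 0\<close> by (intro perturbed_contraction_tendsto_zero[of v "\<lambda>k. \<kappa> * \<beta> k" \<eta>]) auto
  have "(\<lambda>k. (norm (y k - x\<^sub>d))\<^sup>2) \<longlonglongrightarrow> 0"
  proof (rule tendsto_sandwich[where f = "\<lambda>_. 0" and h = "\<lambda>k. 2 / \<mu> * v k"])
    show "\<forall>\<^sub>F k in sequentially. (norm (y k - x\<^sub>d))\<^sup>2 \<le> 2 / \<mu> * v k"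
      using x\<^sub>d(2)[OF subsetD[OF KX y(1)]] \<open>0 < \<mu>\<close> by (simp add: v_def field_simps)
    show "(\<lambda>k. 2 / \<mu> * v k) \<longlonglongrightarrow> 0" using tendsto_mult_right_zero[OF v0] .
  qed auto
  then have "(\<lambda>k. norm (y k - x\<^sub>d)) \<longlonglongrightarrow> 0" using tendsto_real_sqrt by fastforce
  then show ?thesis by (simp add: tendsto_norm_zero_iff LIM_zero_iff)
qed


section \<open>The pseudo-gradient and the response map\<close>

lemma strategy_space_compact_convex:
  fixes S :: "'n::finite \<Rightarrow> real set"
  assumes "\<And>i. compact (S i)" "\<And>i. convex (S i)"
  shows "compact (strategy_space S)" "convex (strategy_space S)"
proof -
  have "\<exists>b. \<forall>t\<in>S i. \<bar>t\<bar> \<le> b" for i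
    using compact_imp_bounded[OF assms(1)[of i]] by (auto simp: bounded_iff)
  then obtain b where b: "\<bar>t\<bar> \<le> b i" if "t \<in> S i" for i t
    by metis
  have "norm x \<le> sum b UNIV" if "x \<in> strategy_space S" for x
  proof -
    have "norm x \<le> (\<Sum>i\<in>UNIV. \<bar>x $ i\<bar>)" by (rule norm_le_l1_cart)
    also have "\<dots> \<le> sum b UNIV" using that b by (intro sum_mono) (auto simp: strategy_space_def)
    finally show ?thesis .
  qed
  then have "bounded (strategy_space S)" by (auto simp: bounded_iff)
  moreover have "closed (strategy_space S)"
  proof -
    have "strategy_space S = (\<Inter>i. (\<lambda>x. x $ i) -` S i)" by (auto simp: strategy_space_def)
    then show ?thesis
      by (auto intro!: closed_INT closed_vimage compact_imp_closed[OF assms(1)] continuous_intros)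
  qed
  ultimately show "compact (strategy_space S)" by (simp add: compact_eq_bounded_closed)
  show "convex (strategy_space S)"
    using assms(2) unfolding strategy_space_def convex_def by auto
qed

text \<open>An interior point of the product shows that no factor is a singleton, so the partial derivatives
  within the factors, which define the pseudo-gradient, are unique.\<close>

lemma strategy_islimpt:
  fixes S :: "'n::finite \<Rightarrow> real set"
  assumes "convex (S i)" and int: "x\<^sub>d \<in> interior (strategy_space S)" and x: "x \<in> strategy_space S"
  shows "x $ i islimpt S i"
proof (rule connected_imp_perfect)
  show "connected (S i)" using assms(1) by (rule convex_connected)
  show "x $ i \<in> S i" using x by (simp add: strategy_space_def)
  obtain e where e: "0 < e" "cball x\<^sub>d e \<subseteq> strategy_space S"
    using int by (auto simp: mem_interior_cball)
  have "x\<^sub>d \<in> strategy_space S" "x\<^sub>d + e *\<^sub>R axis i 1 \<in> strategy_space S"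
    using e by (auto simp: dist_norm norm_axis_1 intro!: subsetD[OF e(2)])
  then have "x\<^sub>d $ i \<in> S i" "(x\<^sub>d + e *\<^sub>R axis i 1) $ i \<in> S i"
    unfolding strategy_space_def by blast+
  then have "x\<^sub>d $ i \<in> S i" "x\<^sub>d $ i + e \<in> S i" by simp_all
  then show "S i \<noteq> {t}" for t using e(1) by auto
qed

lemma pseudo_gradient_nth:
  fixes S :: "'n::finite \<Rightarrow> real set"
  assumes x: "x \<in> strategy_space S" "x $ i islimpt S i"
    and l: "(l i has_derivative (\<lambda>h. g \<bullet> h)) (at x within strategy_space S)"
  shows "pseudo_gradient S l x $ i = g $ i"
proof -
  define \<gamma> where "\<gamma> t = (\<chi> j. if j = i then t else x $ j)" for t :: real
  have \<gamma>_line: "\<gamma> t = x + (t - x $ i) *\<^sub>R axis i 1" for t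
    by (simp add: \<gamma>_def vec_eq_iff axis_def)
  have "(\<gamma> has_derivative (\<lambda>h. h *\<^sub>R axis i 1)) (at (x $ i) within S i)"
    unfolding \<gamma>_line by (auto intro!: derivative_eq_intros)
  moreover have "(l i has_derivative (\<lambda>h. g \<bullet> h)) (at (\<gamma> (x $ i)) within \<gamma> ` S i)"
  proof (rule has_derivative_subset)
    show "(l i has_derivative (\<lambda>h. g \<bullet> h)) (at (\<gamma> (x $ i)) within strategy_space S)"
      using l by (simp add: \<gamma>_line)
    show "\<gamma> ` S i \<subseteq> strategy_space S"
      using x(1) by (auto simp: strategy_space_def \<gamma>_def)
  qed
  ultimately have "((\<lambda>t. l i (\<gamma> t)) has_derivative (\<lambda>h. g \<bullet> (h *\<^sub>R axis i 1))) (at (x $ i) within S i)"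
    by (rule has_derivative_in_compose)
  then have "((\<lambda>t. l i (\<gamma> t)) has_vector_derivative g $ i) (at (x $ i) within S i)"
    by (simp add: has_vector_derivative_def inner_axis)
  then show ?thesis
    using x(2) by (simp add: pseudo_gradient_def \<gamma>_def vector_derivative_within trivial_limit_within)
qed

lemma pseudo_gradient_has_derivative_jacobian:
  fixes S :: "'n::finite \<Rightarrow> real set"
  defines "X \<equiv> strategy_space S"
  assumes limpt: "\<And>x i. x \<in> X \<Longrightarrow> x $ i islimpt S i" and C2: "\<And>i. C2_on (l i) X" and y: "y \<in> X"
  shows "(pseudo_gradient S l has_derivative (\<lambda>h. jacobian (pseudo_gradient S l) (at y within X) *v h)) (at y within X)"
proof -
  have "\<forall>i. \<exists>g H. (\<forall>x\<in>X. (l i has_derivative (\<lambda>h. g x \<bullet> h)) (at x within X)) \<and>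
      (\<forall>x\<in>X. (g has_derivative (\<lambda>h. H x *v h)) (at x within X))"
    using C2 unfolding C2_on_def by blast
  then obtain g H where g: "\<And>i x. x \<in> X \<Longrightarrow> (l i has_derivative (\<lambda>h. g i x \<bullet> h)) (at x within X)"
    and H: "\<And>i x. x \<in> X \<Longrightarrow> (g i has_derivative (\<lambda>h. H i x *v h)) (at x within X)"
    by metis
  have "((\<lambda>x. \<chi> i. g i x $ i) has_derivative (\<lambda>h. \<chi> i. (H i y *v h) $ i)) (at y within X)"
    unfolding has_derivative_componentwise_within[of "\<lambda>x. \<chi> i. g i x $ i"]
    by (auto simp: Basis_vec_def inner_axis intro!: bounded_linear.has_derivative[OF bounded_linear_vec_nth] H y)
  then have "(pseudo_gradient S l has_derivative (\<lambda>h. \<chi> i. (H i y *v h) $ i)) (at y within X)"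
    using y limpt g unfolding X_def
    by (intro has_derivative_transform[OF _ _ \<open>((\<lambda>x. \<chi> i. g i x $ i) has_derivative _) _\<close>[unfolded X_def]])
       (auto simp: vec_eq_iff pseudo_gradient_nth)
  then show ?thesis
    using jacobian_works differentiable_def by blast
qed

text \<open>Only the symmetric part of a matrix contributes to its quadratic form, so the bound on \<open>Sym (J u)\<close>
  bounds the derivative of \<open>\<lambda>t. G (z + t *\<^sub>R (y - z)) \<bullet> (y - z)\<close> from below.\<close>

lemma strongly_monotone_of_Sym_jacobian:
  fixes G :: "real^'n \<Rightarrow> real^'n"
  assumes "convex X"
    and G: "\<And>y. y \<in> X \<Longrightarrow> (G has_derivative (\<lambda>h. J y *v h)) (at y within X)"
    and J: "\<And>y. y \<in> X \<Longrightarrow> Sym (J y) \<succeq> m *\<^sub>R mat 1"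
    and yz: "y \<in> X" "z \<in> X"
  shows "m * (norm (y - z))\<^sup>2 \<le> (G y - G z) \<bullet> (y - z)"
proof -
  let ?d = "y - z"
  define \<gamma> where "\<gamma> t = z + t *\<^sub>R ?d" for t
  have quadratic: "m * (norm v)\<^sup>2 \<le> (J u *v v) \<bullet> v" if "u \<in> X" for u v
  proof -
    have transpose: "v \<bullet> (v v* J u) = v \<bullet> (J u *v v)"
      by (metis dot_lmul_matrix inner_commute)
    have "0 \<le> v \<bullet> ((Sym (J u) - m *\<^sub>R mat 1) *v v)"
      using J[OF that] by (simp add: loewner_ge_def psd_def)
    also have "\<dots> = v \<bullet> (Sym (J u) *v v) - m * (v \<bullet> v)"
      by (simp add: matrix_vector_mult_diff_rdistrib scaleR_matrix_vector_assoc[symmetric] inner_diff_right)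
    also have "v \<bullet> (Sym (J u) *v v) = (J u *v v) \<bullet> v"
      by (simp add: Sym_def matrix_vector_mult_add_rdistrib scaleR_matrix_vector_assoc[symmetric]
          inner_add_right transpose inner_commute[of "J u *v v"])
    finally show ?thesis by (simp add: power2_norm_eq_inner)
  qed
  have \<gamma>: "\<gamma> t \<in> X" if "t \<in> {0..1}" for t
  proof -
    have "\<gamma> t = (1 - t) *\<^sub>R z + t *\<^sub>R y" by (simp add: \<gamma>_def algebra_simps)
    then show ?thesis using convexD_alt[OF \<open>convex X\<close> yz(2,1)] that by auto
  qed
  have "((\<lambda>t. G (\<gamma> t) \<bullet> ?d) has_derivative (\<lambda>h. h * ((J (\<gamma> t) *v ?d) \<bullet> ?d))) (at t within {0..1})"
    if "t \<in> {0..1}" for t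
  proof -
    have "(\<gamma> has_derivative (\<lambda>h. h *\<^sub>R ?d)) (at t within {0..1})"
      unfolding \<gamma>_def by (auto intro!: derivative_eq_intros)
    then have "((\<lambda>t. G (\<gamma> t)) has_derivative (\<lambda>h. J (\<gamma> t) *v (h *\<^sub>R ?d))) (at t within {0..1})"
      using that \<gamma> by (intro has_derivative_in_compose2[where t = X and g' = "\<lambda>y h. J y *v h", OF G]) auto
    then have "((\<lambda>t. G (\<gamma> t) \<bullet> ?d) has_derivative (\<lambda>h. (J (\<gamma> t) *v (h *\<^sub>R ?d)) \<bullet> ?d)) (at t within {0..1})"
      by (rule has_derivative_inner_left)
    then show ?thesis by (simp add: matrix_vector_mult_scaleR)
  qed
  then obtain t where t: "t \<in> {0..1}" "G (\<gamma> 1) \<bullet> ?d - G (\<gamma> 0) \<bullet> ?d = (1 - 0) * ((J (\<gamma> t) *v ?d) \<bullet> ?d)"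
    using mvt_very_simple[of 0 1 "\<lambda>t. G (\<gamma> t) \<bullet> ?d" "\<lambda>t h. h * ((J (\<gamma> t) *v ?d) \<bullet> ?d)"] by auto
  then have "(G y - G z) \<bullet> ?d = (J (\<gamma> t) *v ?d) \<bullet> ?d"
    by (simp add: \<gamma>_def inner_diff_left)
  then show ?thesis using quadratic[OF \<gamma>[OF t(1)], of ?d] by simp
qed

text \<open>A Lipschitz Jacobian is bounded on a bounded set.\<close>

lemma lipschitz_of_lipschitz_jacobian:
  fixes G :: "real^'n \<Rightarrow> real^'n"
  assumes X: "convex X" "bounded X"
    and G: "\<And>y. y \<in> X \<Longrightarrow> (G has_derivative (\<lambda>h. J y *v h)) (at y within X)"
    and J: "\<And>y z. y \<in> X \<Longrightarrow> z \<in> X \<Longrightarrow> onorm ((*v) (J y - J z)) \<le> L * norm (y - z)"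
  obtains \<Lambda> where "0 < \<Lambda>" "\<Lambda>-lipschitz_on X G"
proof (cases "X = {}")
  case True
  then show thesis using that[of 1] by (simp add: lipschitz_on_def)
next
  case False
  then obtain w where w: "w \<in> X" by blast
  obtain D where D: "norm (y - w) \<le> D" if "y \<in> X" for y
    using X(2) w by (metis diameter_bounded_bound dist_norm)
  define \<Lambda> where "\<Lambda> = onorm ((*v) (J w)) + \<bar>L\<bar> * D + 1"
  have D0: "0 \<le> D" using D[OF w] by simp
  have "onorm ((*v) (J w)) \<ge> 0" by (intro onorm_pos_le matrix_vector_mul_bounded_linear)
  then have "0 < \<Lambda>" using D0 by (simp add: \<Lambda>_def add_nonneg_pos)
  have "onorm ((*v) (J y)) \<le> \<Lambda>" if "y \<in> X" for y
  proof -
    have "(*v) (J y) = (\<lambda>h. J w *v h + (J y - J w) *v h)"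
      by (simp add: matrix_vector_mult_diff_rdistrib)
    then have "onorm ((*v) (J y)) \<le> onorm ((*v) (J w)) + onorm ((*v) (J y - J w))"
      using onorm_triangle[OF matrix_vector_mul_bounded_linear matrix_vector_mul_bounded_linear, of "J w" "J y - J w"]
      by simp
    also have "onorm ((*v) (J y - J w)) \<le> L * norm (y - w)" using J that w by blast
    also have "\<dots> \<le> \<bar>L\<bar> * D" using D[OF that] by (intro mult_mono) auto
    finally show ?thesis by (simp add: \<Lambda>_def)
  qed
  then have "\<Lambda>-lipschitz_on X G"
    using differentiable_bound[OF X(1) G] \<open>0 < \<Lambda>\<close> by (intro lipschitz_onI) (auto simp: dist_norm)
  with \<open>0 < \<Lambda>\<close> show thesis by (rule that)
qed

text \<open>Under this incentive the pseudo-gradient vanishes at \<open>y\<close>, which makes \<open>y\<close> an equilibrium, and strong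
  monotonicity excludes any other solution of the variational inequality. This turns the incentive
  dynamics into dynamics of the responses.\<close>

lemma response_neg_pseudo_gradient:
  fixes S :: "'n::finite \<Rightarrow> real set"
  assumes "0 < m" and y: "y \<in> strategy_space S"
    and mono: "\<And>z. z \<in> strategy_space S \<Longrightarrow>
      m * (norm (z - y))\<^sup>2 \<le> (pseudo_gradient S l z - pseudo_gradient S l y) \<bullet> (z - y)"
  shows "response S l (- pseudo_gradient S l y) = y"
  unfolding response_def
proof (rule the_equality)
  show "incentivized_nash S l (- pseudo_gradient S l y) y"
    using y by (simp add: incentivized_nash_def incentivized_pseudo_gradient_def)
next
  fix z assume z: "incentivized_nash S l (- pseudo_gradient S l y) z"
  then have "0 \<le> (pseudo_gradient S l z - pseudo_gradient S l y) \<bullet> (y - z)"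
    using y by (simp add: incentivized_nash_def incentivized_pseudo_gradient_def)
  also have "\<dots> = - ((pseudo_gradient S l z - pseudo_gradient S l y) \<bullet> (z - y))"
    by (simp flip: inner_minus_right)
  finally have "m * (norm (z - y))\<^sup>2 \<le> 0"
    using mono[of z] z by (simp add: incentivized_nash_def)
  then show "z = y" using \<open>0 < m\<close> by (simp add: mult_le_0_iff)
qed

lemma inverse_lipschitz_of_strongly_monotone:
  fixes G :: "'a::real_inner \<Rightarrow> 'a"
  assumes "0 < m" and mono: "\<And>y z. y \<in> X \<Longrightarrow> z \<in> X \<Longrightarrow> m * (norm (y - z))\<^sup>2 \<le> (G y - G z) \<bullet> (y - z)"
    and R: "\<And>y. y \<in> X \<Longrightarrow> R (- G y) = y"
  shows "(1 / m)-lipschitz_on ((\<lambda>y. - G y) ` X) R"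
proof (rule lipschitz_onI)
  fix q r assume "q \<in> (\<lambda>y. - G y) ` X" "r \<in> (\<lambda>y. - G y) ` X"
  then obtain y z where yz: "y \<in> X" "z \<in> X" "q = - G y" "r = - G z" by auto
  have "m * (norm (y - z))\<^sup>2 \<le> norm (G y - G z) * norm (y - z)"
    using mono[OF yz(1,2)] norm_cauchy_schwarz order_trans by blast
  then have "m * norm (y - z) \<le> norm (G y - G z)"
    by (cases "norm (y - z) = 0") (auto simp: power2_eq_square)
  then show "dist (R q) (R r) \<le> 1 / m * dist q r"
    using \<open>0 < m\<close> R yz by (simp add: dist_norm norm_minus_commute field_simps)
qed (use \<open>0 < m\<close> in simp)

text \<open>Monotonicity in the first argument reduces all radii up to \<open>D\<close> to \<open>D\<close> itself.\<close>

lemma class_KL_uniform_settling_time: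
  assumes KL: "class_KL \<phi>" and "0 < \<epsilon>" "0 \<le> D"
  obtains T where "0 \<le> T" "\<And>r t. 0 \<le> r \<Longrightarrow> r \<le> D \<Longrightarrow> T \<le> t \<Longrightarrow> \<phi> r t \<le> \<epsilon>"
proof -
  have "(\<phi> D \<longlongrightarrow> 0) at_top" using KL \<open>0 \<le> D\<close> by (simp add: class_KL_def)
  then have "\<forall>\<^sub>F t in at_top. \<phi> D t < \<epsilon>" using \<open>0 < \<epsilon>\<close> by (rule order_tendstoD)
  then obtain T where T: "\<phi> D t < \<epsilon>" if "T \<le> t" for t by (auto simp: eventually_at_top_linorder)
  show thesis
  proof (rule that[of "max 0 T"])
    fix r t assume r: "0 \<le> r" "r \<le> D" and t: "max 0 T \<le> t"
    have "strict_mono_on {0..} (\<lambda>r. \<phi> r t)" using KL t by (simp add: class_KL_def)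
    then have "\<phi> r t \<le> \<phi> D t" using r by (intro strict_mono_on_leD[where f = "\<lambda>r. \<phi> r t"]) auto
    also have "\<dots> \<le> \<epsilon>" using T[of t] t by simp
    finally show "\<phi> r t \<le> \<epsilon>" .
  qed simp
qed

text \<open>The gradient vanishes at an interior minimizer.\<close>

lemma strongly_convex_on_quadratic_growth:
  assumes convex: "strongly_convex_on \<mu> X \<Phi>" and min: "is_arg_min \<Phi> (\<lambda>y. y \<in> X) x\<^sub>d" "x\<^sub>d \<in> interior X"
    and y: "y \<in> X"
  shows "\<mu> / 2 * (norm (y - x\<^sub>d))\<^sup>2 \<le> \<Phi> y - \<Phi> x\<^sub>d"
proof -
  let ?g = "gradient_within \<Phi> X x\<^sub>d"
  have x\<^sub>d: "x\<^sub>d \<in> X" using min(1) by (simp add: is_arg_min_def)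
  have "\<Phi> differentiable (at x\<^sub>d within X)"
    using convex x\<^sub>d by (simp add: strongly_convex_on_def differentiable_on_def)
  then have "(\<Phi> has_derivative (\<lambda>h. ?g \<bullet> h)) (at x\<^sub>d)"
    using has_derivative_gradient_within at_within_interior[OF min(2)] by metis
  moreover have "\<forall>\<^sub>F y in at x\<^sub>d. \<Phi> x\<^sub>d \<le> \<Phi> y"
  proof -
    have "\<forall>\<^sub>F y in at x\<^sub>d. y \<in> interior X"
      using min(2) by (intro eventually_at_in_open') auto
    then show ?thesis
    proof eventually_elim
      case (elim y)
      then have "y \<in> X" using interior_subset by blast
      then show ?case using min(1) by (auto simp: is_arg_min_def not_less)
    qed
  qed
  ultimately have "(\<lambda>h. ?g \<bullet> h) = (\<lambda>h. 0)" by (rule has_derivative_local_min)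
  then have "?g \<bullet> (y - x\<^sub>d) = 0" by (rule fun_cong)
  moreover have "\<Phi> x\<^sub>d + ?g \<bullet> (y - x\<^sub>d) + \<mu> / 2 * (norm (y - x\<^sub>d))\<^sup>2 \<le> \<Phi> y"
    using convex x\<^sub>d y unfolding strongly_convex_on_def by blast
  ultimately show ?thesis by simp
qed

section \<open>Convergence of the two-time-scale recursion\<close>

theorem theorem2:
  fixes S :: "'n::finite \<Rightarrow> real set"
    and l :: "'n \<Rightarrow> real^'n \<Rightarrow> real"
    and X P\<^sub>c :: "(real^'n) set"
    and G\<^sub>0 xstar :: "real^'n \<Rightarrow> real^'n"
    and \<Phi> :: "real^'n \<Rightarrow> real"
    and x\<^sub>d p\<^sub>d :: "real^'n"
    and f :: "(real^'n) \<times> (real^'n) \<Rightarrow> real^'n"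
    and a \<beta> :: "nat \<Rightarrow> real"
    and x p :: "nat \<Rightarrow> real^'n"
    and L\<^sub>1 L\<^sub>2 L\<^sub>f \<mu> c cstar :: real
  assumes strategies: "\<And>i. compact (S i)" "\<And>i. convex (S i)"
    and X: "X = strategy_space S"
    and costs: "\<And>i. C2_on (l i) X"
    and G\<^sub>0: "G\<^sub>0 = pseudo_gradient S l"
    and xstar: "xstar = response S l"
    and A1_lipschitz: "\<forall>y\<in>X. \<forall>z\<in>X.
        onorm ((*v) (jacobian G\<^sub>0 (at y within X) - jacobian G\<^sub>0 (at z within X))) \<le> L\<^sub>1 * norm (y - z)"
    and A1_monotone: "\<exists>m>0. \<forall>y\<in>X. Sym (jacobian G\<^sub>0 (at y within X)) \<succeq> (m / 2) *\<^sub>R mat 1"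
    and A2_convex: "strongly_convex_on \<mu> X \<Phi>"
    and A2_lipschitz: "L\<^sub>2-lipschitz_on X (gradient_within \<Phi> X)"
    and A2_minimizer: "is_arg_min \<Phi> (\<lambda>y. y \<in> X) x\<^sub>d" "x\<^sub>d \<in> interior X"
    and cstar: "cstar = (INF y\<in>frontier X. \<Phi> y) - \<Phi> x\<^sub>d"
    and p\<^sub>d: "p\<^sub>d = - G\<^sub>0 x\<^sub>d"
    and c: "0 < c" "c < cstar"
    and P\<^sub>c: "P\<^sub>c = {q \<in> interior_incentives S l. \<Phi> (xstar q) - \<Phi> x\<^sub>d \<le> c}"
    and A3_maps: "f \<in> X \<times> P\<^sub>c \<rightarrow> X"
    and A3_lipschitz: "L\<^sub>f-lipschitz_on (X \<times> P\<^sub>c) f"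
    and A3_stable: "\<exists>\<phi>. class_KL \<phi> \<and>
        (\<forall>q\<in>P\<^sub>c. \<forall>\<xi> :: real \<Rightarrow> real^'n.
          (\<forall>t\<ge>0. \<xi> t \<in> X \<and> (\<xi> has_vector_derivative f (\<xi> t, q) - \<xi> t) (at t within {0..})) \<longrightarrow>
          (\<forall>t\<ge>0. norm (\<xi> t - xstar q) \<le> \<phi> (norm (\<xi> 0 - xstar q)) t))"
    and A4_range: "\<And>k. 0 < a k" "\<And>k. a k \<le> 1" "\<And>k. 0 < \<beta> k"
    and A4_diverge: "filterlim (\<lambda>n. \<Sum>k<n. a k) at_top sequentially"
        "filterlim (\<lambda>n. \<Sum>k<n. \<beta> k) at_top sequentially"
    and A4_summable: "summable (\<lambda>k. (a k)\<^sup>2 + (\<beta> k)\<^sup>2)"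
    and A4_separation: "(\<lambda>k. \<beta> k / a k) \<longlonglongrightarrow> 0"
    and init: "x 0 \<in> X" "p 0 \<in> P\<^sub>c"
    and x_step: "\<And>k. x (Suc k) = x k + a k *\<^sub>R (f (x k, p k) - x k)"
    and p_step: "\<And>k. p (Suc k) = p k +
        (\<beta> k * indicat_real P\<^sub>c (p k + \<beta> k *\<^sub>R gradient_within \<Phi> X (x k))) *\<^sub>R
          gradient_within \<Phi> X (x k)"
  shows "(\<lambda>k. norm (x k - xstar (p k))) \<longlonglongrightarrow> 0 \<and>
         p \<longlonglongrightarrow> p\<^sub>d \<and>
         (\<lambda>k. (x k, p k)) \<longlonglongrightarrow> (x\<^sub>d, p\<^sub>d)"
proof -
  have X_compact: "compact X" and X_convex: "convex X"
    using strategy_space_compact_convex strategies unfolding X by auto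
  have limpt: "y $ i islimpt S i" if "y \<in> X" for y i
    using strategy_islimpt[of S i x\<^sub>d y] strategies(2) A2_minimizer(2) that unfolding X by blast
  have G\<^sub>0_deriv: "(G\<^sub>0 has_derivative (\<lambda>h. jacobian G\<^sub>0 (at y within X) *v h)) (at y within X)" if "y \<in> X" for y
    using pseudo_gradient_has_derivative_jacobian[of S l y] limpt costs that unfolding X G\<^sub>0 by blast
  obtain \<Lambda> where \<Lambda>: "0 < \<Lambda>" "\<Lambda>-lipschitz_on X G\<^sub>0"
    using lipschitz_of_lipschitz_jacobian[of X G\<^sub>0 "\<lambda>y. jacobian G\<^sub>0 (at y within X)" L\<^sub>1]
      X_convex compact_imp_bounded[OF X_compact] G\<^sub>0_deriv A1_lipschitz by blast
  obtain m where m: "0 < m" and mono: "\<And>y z. y \<in> X \<Longrightarrow> z \<in> X \<Longrightarrow> m * (norm (y - z))\<^sup>2 \<le> (G\<^sub>0 y - G\<^sub>0 z) \<bullet> (y - z)"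
  proof -
    obtain m where m: "0 < m" "\<forall>y\<in>X. Sym (jacobian G\<^sub>0 (at y within X)) \<succeq> (m / 2) *\<^sub>R mat 1"
      using A1_monotone by blast
    show thesis
      using m by (intro that[of "m / 2"] strongly_monotone_of_Sym_jacobian[OF X_convex G\<^sub>0_deriv]) auto
  qed
  have response: "xstar (- G\<^sub>0 y) = y" if "y \<in> X" for y
    using response_neg_pseudo_gradient[of m y S l] m mono that unfolding X G\<^sub>0 xstar by blast

  let ?g = "gradient_within \<Phi> X"
  have \<mu>: "0 < \<mu>" and \<Phi>_diff: "\<Phi> differentiable_on X"
    and convex: "\<And>y z. y \<in> X \<Longrightarrow> z \<in> X \<Longrightarrow> \<Phi> z \<ge> \<Phi> y + ?g y \<bullet> (z - y) + \<mu> / 2 * (norm (z - y))\<^sup>2"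
    using A2_convex by (auto simp: strongly_convex_on_def)
  have x\<^sub>d: "x\<^sub>d \<in> X" "\<And>y. y \<in> X \<Longrightarrow> \<Phi> x\<^sub>d \<le> \<Phi> y"
    using A2_minimizer(1) by (auto simp: is_arg_min_def not_less)
  have growth: "\<mu> / 2 * (norm (y - x\<^sub>d))\<^sup>2 \<le> \<Phi> y - \<Phi> x\<^sub>d" if "y \<in> X" for y
    using strongly_convex_on_quadratic_growth[OF A2_convex A2_minimizer that] .
  have "compact (?g ` X)"
    by (intro compact_continuous_image X_compact lipschitz_on_continuous_on[OF A2_lipschitz])
  then obtain B where B: "norm (?g y) \<le> B" if "y \<in> X" for y
    using compact_imp_bounded bounded_iff by (metis imageI)
  have B0: "0 \<le> B" using B[OF x\<^sub>d(1)] norm_ge_zero order_trans by blast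

  define K where "K = {y \<in> X. \<Phi> y - \<Phi> x\<^sub>d \<le> c}"
  have KX: "K \<subseteq> X" by (auto simp: K_def)
  have K_interior: "K \<subseteq> interior X"
  proof
    fix y assume y: "y \<in> K"
    have closed: "closed X" using X_compact by (rule compact_imp_closed)
    \<comment> \<open>a point of the sublevel set on the boundary would force \<open>cstar \<le> c\<close>\<close>
    have "bdd_below (\<Phi> ` frontier X)"
      using x\<^sub>d(2) frontier_subset_closed[OF closed] by (intro bdd_belowI2[of _ "\<Phi> x\<^sub>d"]) auto
    then have "cstar \<le> \<Phi> y - \<Phi> x\<^sub>d" if "y \<in> frontier X"
      unfolding cstar using cINF_lower[OF _ that] by auto
    then have "y \<notin> frontier X" using y c(2) by (auto simp: K_def)
    then show "y \<in> interior X" using y closed by (auto simp: frontier_def K_def)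
  qed
  have P\<^sub>c_image: "P\<^sub>c = (\<lambda>y. - G\<^sub>0 y) ` K"
    using K_interior response interior_subset[of X]
    unfolding P\<^sub>c interior_incentives_def G\<^sub>0[symmetric] X[symmetric] by (auto simp: K_def)
  have xstar_in: "xstar q \<in> K" "- G\<^sub>0 (xstar q) = q" if "q \<in> P\<^sub>c" for q
    using that response KX unfolding P\<^sub>c_image by auto
  have xstar_lipschitz: "(1 / m)-lipschitz_on P\<^sub>c xstar"
    unfolding P\<^sub>c_image using m mono response KX
    by (intro inverse_lipschitz_of_strongly_monotone) auto

  have p_in: "p k \<in> P\<^sub>c" for k
  proof (induction k)
    case (Suc k)
    then show ?case
      by (cases "p k + \<beta> k *\<^sub>R ?g (x k) \<in> P\<^sub>c") (simp_all add: p_step)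
  qed (rule init)
  have x_in: "x k \<in> X" for k
  proof (induction k)
    case (Suc k)
    have "f (x k, p k) \<in> X" using A3_maps Suc p_in by auto
    moreover have "x (Suc k) = (1 - a k) *\<^sub>R x k + a k *\<^sub>R f (x k, p k)"
      by (simp add: x_step algebra_simps)
    ultimately show ?case
      using convexD_alt[OF X_convex Suc] A4_range(1,2)[of k] by (simp add: less_imp_le)
  qed (rule init)
  have p_slow: "norm (p (Suc k) - p k) \<le> B * \<beta> k" for k
    using B[OF x_in[of k]] A4_range(3)[of k] B0
    by (cases "p k + \<beta> k *\<^sub>R ?g (x k) \<in> P\<^sub>c") (simp_all add: p_step mult.commute)

  have squares: "(\<lambda>k. sqrt ((a k)\<^sup>2 + (\<beta> k)\<^sup>2)) \<longlonglongrightarrow> 0"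
    using tendsto_real_sqrt[OF summable_LIMSEQ_zero[OF A4_summable]] by simp
  have a0: "a \<longlonglongrightarrow> 0"
    by (intro tendsto_sandwich[OF _ _ tendsto_const squares] always_eventually allI
        less_imp_le[OF A4_range(1)] real_le_rsqrt) auto
  have \<beta>0: "\<beta> \<longlonglongrightarrow> 0"
    by (intro tendsto_sandwich[OF _ _ tendsto_const squares] always_eventually allI
        less_imp_le[OF A4_range(3)] real_le_rsqrt) auto

  have attracting: "\<exists>T\<ge>0. \<forall>q\<in>P\<^sub>c. \<forall>\<xi> :: real \<Rightarrow> real^'n.
      (\<forall>t\<ge>0. \<xi> t \<in> X \<and> (\<xi> has_vector_derivative f (\<xi> t, q) - \<xi> t) (at t within {0..})) \<longrightarrow>
      (\<forall>t\<ge>T. norm (\<xi> t - xstar q) \<le> \<epsilon>)" if \<epsilon>: "0 < \<epsilon>" for \<epsilon>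
  proof -
    obtain \<phi> where KL: "class_KL \<phi>" and stable: "\<And>q (\<xi> :: real \<Rightarrow> real^'n) t. q \<in> P\<^sub>c \<Longrightarrow>
        (\<forall>t\<ge>0. \<xi> t \<in> X \<and> (\<xi> has_vector_derivative f (\<xi> t, q) - \<xi> t) (at t within {0..})) \<Longrightarrow>
        0 \<le> t \<Longrightarrow> norm (\<xi> t - xstar q) \<le> \<phi> (norm (\<xi> 0 - xstar q)) t"
      using A3_stable by blast
    obtain D where D: "norm (y - z) \<le> D" if "y \<in> X" "z \<in> X" for y z
      using compact_imp_bounded[OF X_compact] by (metis diameter_bounded_bound dist_norm)
    have "0 \<le> D" using D[OF x\<^sub>d(1) x\<^sub>d(1)] by simp
    then obtain T where T: "0 \<le> T" "\<And>r t. 0 \<le> r \<Longrightarrow> r \<le> D \<Longrightarrow> T \<le> t \<Longrightarrow> \<phi> r t \<le> \<epsilon>"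
      using class_KL_uniform_settling_time[OF KL \<epsilon>] by blast
    have "norm (\<xi> t - xstar q) \<le> \<epsilon>" if q: "q \<in> P\<^sub>c" and t: "T \<le> t"
      and \<xi>: "\<forall>t\<ge>0. \<xi> t \<in> X \<and> (\<xi> has_vector_derivative f (\<xi> t, q) - \<xi> t) (at t within {0..})" for q t \<xi>
    proof -
      have "norm (\<xi> t - xstar q) \<le> \<phi> (norm (\<xi> 0 - xstar q)) t" using stable[OF q \<xi>] T(1) t by simp
      also have "\<dots> \<le> \<epsilon>" using \<xi> xstar_in[OF q] KX t by (intro T(2) D) auto
      finally show ?thesis .
    qed
    then show ?thesis using T(1) by blast
  qed
  have tracking: "(\<lambda>k. norm (x k - xstar (p k))) \<longlonglongrightarrow> 0"
    by (rule fast_iterate_tracks_response[OF X_compact X_convex A3_maps A3_lipschitz xstar_lipschitz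
        attracting A4_range(1,2) a0 A4_diverge(1) A4_separation x_in x_step p_in p_slow B0])

  have "continuous_on X \<Phi>" using \<Phi>_diff by (rule differentiable_imp_continuous_on)
  then have y_lim: "(\<lambda>k. xstar (p k)) \<longlonglongrightarrow> x\<^sub>d"
    using p_step xstar_in[OF p_in] unfolding P\<^sub>c_image
    by (intro guarded_incentive_response_converges[OF X_compact \<mu> convex _ A2_lipschitz x\<^sub>d(1) growth
          m mono \<Lambda>(2,1) c(1) K_def K_interior A4_range(3) \<beta>0 A4_diverge(2) _ _ x_in tracking]) auto
  have "(\<lambda>k. - G\<^sub>0 (xstar (p k))) \<longlonglongrightarrow> - G\<^sub>0 x\<^sub>d"
    by (intro tendsto_minus continuous_on_tendsto_compose[OF lipschitz_on_continuous_on[OF \<Lambda>(2)] y_lim]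
        always_eventually allI subsetD[OF KX xstar_in(1)[OF p_in]] x\<^sub>d(1))
  then have p_lim: "p \<longlonglongrightarrow> p\<^sub>d" by (simp add: p\<^sub>d xstar_in p_in)
  have "(\<lambda>k. (x k - xstar (p k)) + xstar (p k)) \<longlonglongrightarrow> 0 + x\<^sub>d"
    using tracking y_lim by (intro tendsto_add) (simp_all add: tendsto_norm_zero_iff)
  then have "x \<longlonglongrightarrow> x\<^sub>d" by simp
  then show ?thesis using tracking p_lim by (intro conjI tendsto_Pair) auto
qed

end
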